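(* Let $K$ be an arbitrary field, $n>2$, and $G=\mathrm{Aut}_0(K[x_1,\dots,x_n])$. Then $G$ cannot be isomorphic to any subgroup $H$ of $\mathrm{Aut}(K\langle x_1,\dots,x_n\rangle)$ via the isomorphism induced by the natural abelianization; that is, there is no subgroup $H\subseteq\mathrm{Aut}(K\langle x_1,\dots,x_n\rangle)$ such that the natural homomorphism $\mathrm{Aut}(K\langle x_1,\dots,x_n\rangle)\to\mathrm{Aut}(K[x_1,\dots,x_n])$ restricts to an isomorphism $H\to G$. The same is true with $G$ replaced by $\mathrm{NAut}(K[x_1,\dots,x_n])$.
   Context: All automorphisms are $K$-algebra automorphisms. $\mathrm{Aut}_0(K[x_1,\dots,x_n])$ is the group of automorphisms preserving the origin, i.e. mapping the augmentation ideal $(x_1,\dots,x_n)$ into itself. The natural abelianization homomorphism $\mathrm{Aut}(K\langle x_1,\dots,x_n\rangle)\to\mathrm{Aut}(K[x_1,\dots,x_n])$ is induced by the quotient map $K\langle x_1,\dots,x_n\rangle\to K[x_1,\dots,x_n]$, $x_i\mapsto x_i$, by the commutator ideal. The tame group $\mathrm{TAut}(K[x_1,\dots,x_n])$ is generated by linear automorphisms and elementary automorphisms $x_i\mapsto x_i+P$, $x_j\mapsto x_j$ ($j\ne i$), $P$ not involving $x_i$. An automorphism $\varphi$ is nice if for every $m$ there are $\psi_m\in\mathrm{Aut}(K[x_1,\dots,x_n])$ and $\phi_m\in\mathrm{TAut}(K[x_1,\dots,x_n])$ with $\varphi=\psi_m\phi_m$ and $\psi_m(x_i)\equiv x_i\bmod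 (x_1,\dots,x_n)^m$ for all $i$. $\mathrm{NAut}(K[x_1,\dots,x_n])$ is the group of nice automorphisms. *)

theory Defs
  imports "HOL-Library.Cardinality" "HOL-Library.Poly_Mapping" "HOL-Algebra.Algebra" "HOL-Algebra.Algebraic_Closure_Type"
begin

text \<open>
  The variables are indexed by a finite type \<open>'v\<close>; their number is \<open>CARD('v)\<close>. Both the
  polynomial ring and the free associative algebra are monoid algebras \<open>'m \<Rightarrow>\<^sub>0 'a\<close> over the
  field \<open>'a\<close>, with monoids written additively: exponent vectors \<open>'v \<Rightarrow>\<^sub>0 nat\<close> in the
  first case, words under concatenation in the second. The product is the convolution product
  of \<^theory>\<open>HOL-Library.Poly_Mapping\<close>, and \<open>single 0 c\<close> is the scalar \<open>c\<close>.
\<close>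

datatype 'v fword = Word (letters: "'v list")

instantiation fword :: (type) monoid_add
begin

definition zero_fword :: "'a fword" where "0 = Word []"

definition plus_fword :: "'a fword \<Rightarrow> 'a fword \<Rightarrow> 'a fword"
  where "u + v = Word (letters u @ letters v)"

instance
  by standard (simp_all add: zero_fword_def plus_fword_def)

end

type_synonym ('v, 'a) free_alg = "'v fword \<Rightarrow>\<^sub>0 'a"
type_synonym ('v, 'a) pring = "('v \<Rightarrow>\<^sub>0 nat) \<Rightarrow>\<^sub>0 'a"

definition fvar :: "'v \<Rightarrow> ('v, 'a::field) free_alg"
  where "fvar i = Poly_Mapping.single (Word [i]) 1"

definition pvar :: "'v \<Rightarrow> ('v, 'a::field) pring"
  where "pvar i = Poly_Mapping.single (Poly_Mapping.single i 1) 1"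


section \<open>Algebra automorphisms\<close>

definition alg_hom :: "(('m::monoid_add \<Rightarrow>\<^sub>0 'a::field) \<Rightarrow> ('k::monoid_add \<Rightarrow>\<^sub>0 'a)) \<Rightarrow> bool"
  where "alg_hom f \<longleftrightarrow>
    (\<forall>p q. f (p + q) = f p + f q) \<and>
    (\<forall>p q. f (p * q) = f p * f q) \<and>
    (\<forall>c. f (Poly_Mapping.single 0 c) = Poly_Mapping.single 0 c)"

definition Aut :: "(('m::monoid_add \<Rightarrow>\<^sub>0 'a::field) \<Rightarrow> ('m \<Rightarrow>\<^sub>0 'a)) monoid"
  where "Aut = \<lparr>carrier = {f. alg_hom f \<and> bij f}, monoid.mult = (\<circ>), one = id\<rparr>"

abbreviation Aut_free :: "(('v, 'a::field) free_alg \<Rightarrow> ('v, 'a) free_alg) monoid"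
  where "Aut_free \<equiv> Aut"

abbreviation Aut_poly :: "(('v, 'a::field) pring \<Rightarrow> ('v, 'a) pring) monoid"
  where "Aut_poly \<equiv> Aut"


section \<open>Abelianization\<close>

definition exponents :: "'v fword \<Rightarrow> ('v \<Rightarrow>\<^sub>0 nat)"
  where "exponents w = (\<Sum>i\<leftarrow>letters w. Poly_Mapping.single i 1)"

definition abel :: "('v, 'a::field) free_alg \<Rightarrow> ('v, 'a) pring"
  where "abel p =
    (\<Sum>w\<in>Poly_Mapping.keys p. Poly_Mapping.single (exponents w) (Poly_Mapping.lookup p w))"

text \<open>
  The automorphism of the polynomial ring induced by \<open>\<phi>\<close>; it exists and is unique for every
  automorphism \<open>\<phi>\<close>, see \<open>abel_aut_unique_existence\<close> below.
\<close>

definition abel_aut ::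
    "(('v, 'a::field) free_alg \<Rightarrow> ('v, 'a) free_alg) \<Rightarrow> (('v, 'a) pring \<Rightarrow> ('v, 'a) pring)"
  where "abel_aut \<phi> = (THE \<psi>. \<psi> \<in> carrier Aut_poly \<and> \<psi> \<circ> abel = abel \<circ> \<phi>)"


section \<open>Groups of polynomial automorphisms\<close>

definition aug_ideal :: "('v, 'a::field) pring set"
  where "aug_ideal = Idl\<^bsub>ring_of_type_algebra\<^esub> (range pvar)"

text \<open>The power is taken in the monoid of ideals under the ideal product.\<close>

definition aug_ideal_power :: "nat \<Rightarrow> ('v, 'a::field) pring set"
  where "aug_ideal_power m = aug_ideal [^]\<^bsub>ideals_set ring_of_type_algebra\<^esub> m"

definition Aut0 :: "(('v, 'a::field) pring \<Rightarrow> ('v, 'a) pring) set"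
  where "Aut0 = {\<phi> \<in> carrier Aut_poly. \<phi> ` aug_ideal \<subseteq> aug_ideal}"

definition linear_auts :: "(('v::finite, 'a::field) pring \<Rightarrow> ('v, 'a) pring) set"
  where "linear_auts = {\<phi> \<in> carrier Aut_poly.
    \<exists>A. \<forall>i. \<phi> (pvar i) = (\<Sum>j\<in>UNIV. Poly_Mapping.single 0 (A i j) * pvar j)}"

definition not_involving :: "'v \<Rightarrow> ('v, 'a::field) pring \<Rightarrow> bool"
  where "not_involving i P \<longleftrightarrow> (\<forall>m\<in>Poly_Mapping.keys P. Poly_Mapping.lookup m i = 0)"

definition elementary_auts :: "(('v, 'a::field) pring \<Rightarrow> ('v, 'a) pring) set"
  where "elementary_auts = {\<phi> \<in> carrier Aut_poly.
    \<exists>i P. not_involving i P \<and> \<phi> (pvar i) = pvar i + P \<and> (\<forall>j. j \<noteq> i \<longrightarrow> \<phi> (pvar j) = pvar j)}"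

definition TAut :: "(('v::finite, 'a::field) pring \<Rightarrow> ('v, 'a) pring) set"
  where "TAut = generate Aut_poly (linear_auts \<union> elementary_auts)"

definition NAut :: "(('v::finite, 'a::field) pring \<Rightarrow> ('v, 'a) pring) set"
  where "NAut = {\<phi> \<in> carrier Aut_poly. \<forall>m. \<exists>\<psi>\<in>carrier Aut_poly. \<exists>\<tau>\<in>TAut.
    \<phi> = \<psi> \<circ> \<tau> \<and> (\<forall>i. \<psi> (pvar i) - pvar i \<in> aug_ideal_power m)}"


section \<open>The induced automorphism is well defined\<close>

lemma Aut_simps [simp]:
  "f \<in> carrier Aut \<longleftrightarrow> alg_hom f \<and> bij f"
  "f \<otimes>\<^bsub>Aut\<^esub> g = f \<circ> g"
  "\<one>\<^bsub>Aut\<^esub> = id"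
  by (simp_all add: Aut_def)

lemma alg_homD:
  assumes "alg_hom f"
  shows "f (p + q) = f p + f q" "f (p * q) = f p * f q"
    "f (Poly_Mapping.single 0 c) = Poly_Mapping.single 0 c" "f 0 = 0" "f 1 = 1"
proof -
  show *: "f (p + q) = f p + f q" "f (p * q) = f p * f q"
    "f (Poly_Mapping.single 0 c) = Poly_Mapping.single 0 c" for p q c
    using assms by (auto simp: alg_hom_def)
  show "f 0 = 0" using *(3)[of 0] by simp
  show "f 1 = 1" using *(3)[of 1] by simp
qed

lemma alg_hom_sum: "alg_hom f \<Longrightarrow> f (sum g A) = (\<Sum>x\<in>A. f (g x))"
  by (induction A rule: infinite_finite_induct) (simp_all add: alg_homD)

lemma alg_hom_comp: "alg_hom f \<Longrightarrow> alg_hom g \<Longrightarrow> alg_hom (f \<circ> g)"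
  by (simp add: alg_hom_def)

lemma alg_hom_id: "alg_hom id"
  by (simp add: alg_hom_def)

lemma alg_hom_inv:
  assumes f: "alg_hom f" and "bij f"
  shows "alg_hom (inv_into UNIV f)"
proof -
  have *: "f (inv_into UNIV f p) = p" "inv_into UNIV f (f q) = q" for p q
    using \<open>bij f\<close> by (simp_all add: bij_is_inj bij_is_surj surj_f_inv_f)
  have "inv_into UNIV f (p + q) = inv_into UNIV f p + inv_into UNIV f q" for p q
    using *(2)[of "inv_into UNIV f p + inv_into UNIV f q"] by (simp only: alg_homD[OF f] *(1))
  moreover have "inv_into UNIV f (p * q) = inv_into UNIV f p * inv_into UNIV f q" for p q
    using *(2)[of "inv_into UNIV f p * inv_into UNIV f q"] by (simp only: alg_homD[OF f] *(1))
  moreover have "inv_into UNIV f (Poly_Mapping.single 0 c) = Poly_Mapping.single 0 c" for c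
    using *(2)[of "Poly_Mapping.single 0 c"] by (simp only: alg_homD[OF f])
  ultimately show ?thesis by (simp add: alg_hom_def)
qed

lemma group_Aut: "group (Aut :: (('m::monoid_add \<Rightarrow>\<^sub>0 'a::field) \<Rightarrow> ('m \<Rightarrow>\<^sub>0 'a)) monoid)"
proof (rule groupI)
  fix f :: "('m \<Rightarrow>\<^sub>0 'a) \<Rightarrow> ('m \<Rightarrow>\<^sub>0 'a)"
  assume "f \<in> carrier Aut"
  then have "alg_hom f" "bij f" by simp_all
  then have "inv_into UNIV f \<in> carrier Aut" "inv_into UNIV f \<otimes>\<^bsub>Aut\<^esub> f = \<one>\<^bsub>Aut\<^esub>"
    by (simp_all add: alg_hom_inv bij_imp_bij_inv bij_is_inj)
  then show "\<exists>g\<in>carrier Aut. g \<otimes>\<^bsub>Aut\<^esub> f = \<one>\<^bsub>Aut\<^esub>" by blast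
qed (simp_all add: alg_hom_comp alg_hom_id bij_comp comp_assoc)

lemma pm_expand:
  "p = (\<Sum>m\<in>Poly_Mapping.keys p. Poly_Mapping.single m (Poly_Mapping.lookup p m))"
  by (rule poly_mapping_eqI)
     (auto simp: lookup_sum lookup_single when_def in_keys_iff sum.delta)

lemma alg_hom_eqI:
  fixes f g :: "('m::monoid_add \<Rightarrow>\<^sub>0 'a::field) \<Rightarrow> ('k::monoid_add \<Rightarrow>\<^sub>0 'a)"
  assumes f: "alg_hom f" and g: "alg_hom g"
    and eq: "\<And>m. f (Poly_Mapping.single m 1) = g (Poly_Mapping.single m 1)"
  shows "f = g"
proof
  fix p
  have "f (Poly_Mapping.single m c) = g (Poly_Mapping.single m c)" for m c
  proof -
    have "Poly_Mapping.single m c = Poly_Mapping.single 0 c * Poly_Mapping.single m 1"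
      by (simp add: mult_single)
    then show ?thesis by (simp only: alg_homD[OF f] alg_homD[OF g] eq)
  qed
  then have "f (\<Sum>m\<in>Poly_Mapping.keys p. Poly_Mapping.single m (Poly_Mapping.lookup p m)) =
      g (\<Sum>m\<in>Poly_Mapping.keys p. Poly_Mapping.single m (Poly_Mapping.lookup p m))"
    by (simp only: alg_hom_sum[OF f] alg_hom_sum[OF g])
  then show "f p = g p" by (simp only: pm_expand[symmetric])
qed

lemma alg_hom_free_eqI:
  fixes f g :: "('v, 'a::field) free_alg \<Rightarrow> ('k::monoid_add \<Rightarrow>\<^sub>0 'a)"
  assumes f: "alg_hom f" and g: "alg_hom g" and eq: "\<And>i. f (fvar i) = g (fvar i)"
  shows "f = g"
proof (rule alg_hom_eqI[OF f g])
  fix w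
  have "f (Poly_Mapping.single (Word xs) 1) = g (Poly_Mapping.single (Word xs) 1)" for xs
  proof (induction xs)
    case Nil
    then show ?case
      using alg_homD(3)[OF f, of 1] alg_homD(3)[OF g, of 1] by (simp add: zero_fword_def)
  next
    case (Cons x xs)
    have "Poly_Mapping.single (Word (x # xs)) (1 :: 'a) = fvar x * Poly_Mapping.single (Word xs) 1"
      by (simp add: fvar_def mult_single plus_fword_def)
    then show ?case by (simp only: alg_homD[OF f] alg_homD[OF g] eq Cons)
  qed
  then show "f (Poly_Mapping.single w 1) = g (Poly_Mapping.single w 1)" by (cases w) simp
qed

text \<open>Multiplicative maps on the monoid extend to algebra homomorphisms.\<close>

definition mon_ext ::
    "('m::monoid_add \<Rightarrow> ('k::comm_monoid_add \<Rightarrow>\<^sub>0 'a::field)) \<Rightarrow> ('m \<Rightarrow>\<^sub>0 'a) \<Rightarrow> ('k \<Rightarrow>\<^sub>0 'a)"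
  where "mon_ext g p =
    (\<Sum>m\<in>Poly_Mapping.keys p. Poly_Mapping.single 0 (Poly_Mapping.lookup p m) * g m)"

lemma mon_ext_superset:
  assumes "finite A" "Poly_Mapping.keys p \<subseteq> A"
  shows "mon_ext g p = (\<Sum>m\<in>A. Poly_Mapping.single 0 (Poly_Mapping.lookup p m) * g m)"
  unfolding mon_ext_def by (rule sum.mono_neutral_left) (use assms in \<open>auto simp: in_keys_iff\<close>)

lemma mon_ext_add: "mon_ext g (p + q) = mon_ext g p + mon_ext g q"
proof -
  let ?A = "Poly_Mapping.keys p \<union> Poly_Mapping.keys q"
  have "finite ?A" "Poly_Mapping.keys (p + q) \<subseteq> ?A"
    by (auto dest: subsetD[OF Poly_Mapping.keys_add])
  then show ?thesis
    by (simp add: mon_ext_superset[of ?A] lookup_add single_add distrib_right sum.distrib)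
qed

lemma mon_ext_0 [simp]: "mon_ext g 0 = 0"
  by (simp add: mon_ext_def)

lemma mon_ext_sum: "mon_ext g (sum h A) = (\<Sum>x\<in>A. mon_ext g (h x))"
  by (induction A rule: infinite_finite_induct) (simp_all add: mon_ext_add)

lemma mon_ext_single: "mon_ext g (Poly_Mapping.single m c) = Poly_Mapping.single 0 c * g m"
  by (cases "c = 0") (simp_all add: mon_ext_def)

lemma alg_hom_mon_ext:
  fixes g :: "'m::monoid_add \<Rightarrow> ('k::comm_monoid_add \<Rightarrow>\<^sub>0 'a::field)"
  assumes "g 0 = 1" "\<And>a b. g (a + b) = g a * g b"
  shows "alg_hom (mon_ext g)"
proof -
  have "mon_ext g (p * q) = mon_ext g p * mon_ext g q" for p q
  proof -
    have single: "mon_ext g (Poly_Mapping.single a c * Poly_Mapping.single b d) =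
        mon_ext g (Poly_Mapping.single a c) * mon_ext g (Poly_Mapping.single b d)" for a b c d
    proof -
      have "Poly_Mapping.single 0 (c * d) =
          (Poly_Mapping.single 0 c * Poly_Mapping.single 0 d :: 'k \<Rightarrow>\<^sub>0 'a)"
        by (simp add: mult_single)
      then show ?thesis by (simp add: mult_single mon_ext_single assms mult_ac)
    qed
    let ?P = "\<lambda>a. Poly_Mapping.single a (Poly_Mapping.lookup p a)"
    let ?Q = "\<lambda>b. Poly_Mapping.single b (Poly_Mapping.lookup q b)"
    have "mon_ext g (sum ?P (Poly_Mapping.keys p) * sum ?Q (Poly_Mapping.keys q)) =
        mon_ext g (sum ?P (Poly_Mapping.keys p)) * mon_ext g (sum ?Q (Poly_Mapping.keys q))"
      by (simp only: sum_product mon_ext_sum single)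
    then show ?thesis by (simp only: pm_expand[symmetric])
  qed
  then show ?thesis
    by (simp add: alg_hom_def mon_ext_add mon_ext_single assms)
qed

lemma abel_eq_mon_ext: "abel = mon_ext (\<lambda>w. Poly_Mapping.single (exponents w) 1)"
  by (rule ext) (simp add: abel_def mon_ext_def mult_single)

lemma alg_hom_abel: "alg_hom abel"
  unfolding abel_eq_mon_ext
  by (rule alg_hom_mon_ext) (simp_all add: exponents_def zero_fword_def plus_fword_def mult_single)

lemma abel_fvar: "abel (fvar i) = pvar i"
  by (simp add: abel_eq_mon_ext fvar_def pvar_def mon_ext_single exponents_def)

lemma surj_exponents: "\<exists>w. exponents w = m"
proof -
  have single: "\<exists>w. exponents w = Poly_Mapping.single k v" for k :: 'a and v
  proof
    show "exponents (Word (replicate v k)) = Poly_Mapping.single k v"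
      by (induction v) (simp_all add: exponents_def single_add[symmetric])
  qed
  have add: "\<exists>w. exponents w = f + g" if fg: "\<exists>w. exponents w = f" "\<exists>w. exponents w = g"
    for f g :: "'a \<Rightarrow>\<^sub>0 nat"
  proof -
    obtain u v where "exponents u = f" "exponents v = g" using fg by blast
    then have "exponents (u + v) = f + g" by (auto simp: exponents_def plus_fword_def)
    then show ?thesis by blast
  qed
  have zero: "\<exists>w. exponents w = (0 :: 'a \<Rightarrow>\<^sub>0 nat)"
    by (rule exI[of _ "Word []"]) (simp add: exponents_def)
  have "\<exists>w. exponents w =
      (\<Sum>k\<in>A. Poly_Mapping.single k (Poly_Mapping.lookup m k))" for A
    by (induction A rule: infinite_finite_induct) (simp_all add: single add zero)
  from this[of "Poly_Mapping.keys m"] show ?thesis by (simp flip: pm_expand)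
qed

lemma surj_abel: "surj (abel :: ('v, 'a::field) free_alg \<Rightarrow> ('v, 'a) pring)"
proof -
  have "q \<in> range abel" for q :: "('v, 'a) pring"
  proof -
    obtain s where s: "exponents (s m) = m" for m :: "'v \<Rightarrow>\<^sub>0 nat" using surj_exponents by metis
    have "abel (\<Sum>m\<in>Poly_Mapping.keys q. Poly_Mapping.single (s m) (Poly_Mapping.lookup q m)) = q"
      by (simp add: abel_eq_mon_ext mon_ext_sum mon_ext_single mult_single s flip: pm_expand)
    then show ?thesis by (metis rangeI)
  qed
  then show ?thesis by blast
qed

definition psubst :: "('v::finite \<Rightarrow> ('v, 'a::field) pring) \<Rightarrow> ('v, 'a) pring \<Rightarrow> ('v, 'a) pring"
  where "psubst \<sigma> = mon_ext (\<lambda>m. \<Prod>i\<in>UNIV. \<sigma> i ^ Poly_Mapping.lookup m i)"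

lemma alg_hom_psubst: "alg_hom (psubst \<sigma>)"
  unfolding psubst_def
  by (rule alg_hom_mon_ext) (simp_all add: lookup_add power_add prod.distrib)

lemma psubst_pvar: "psubst \<sigma> (pvar i) = \<sigma> i"
proof -
  have "psubst \<sigma> (pvar i) = (\<Prod>j\<in>UNIV. if j = i then \<sigma> j else 1)"
    unfolding psubst_def pvar_def mon_ext_single
    by (simp only: single_one mult_1_left, rule prod.cong) (auto simp: lookup_single when_def)
  then show ?thesis by simp
qed

lemma psubst_abel:
  assumes "alg_hom \<phi>"
  shows "psubst (\<lambda>i. abel (\<phi> (fvar i))) \<circ> abel = abel \<circ> \<phi>"
  by (rule alg_hom_free_eqI)
     (simp_all add: alg_hom_comp alg_hom_psubst alg_hom_abel assms abel_fvar psubst_pvar)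

lemma abel_aut_unique_existence:
  fixes \<phi> :: "('v::finite, 'a::field) free_alg \<Rightarrow> ('v, 'a) free_alg"
  assumes "\<phi> \<in> carrier Aut_free"
  shows "\<exists>!\<psi>. \<psi> \<in> carrier Aut_poly \<and> \<psi> \<circ> abel = abel \<circ> \<phi>"
proof (rule ex_ex1I)
  have \<phi>: "alg_hom \<phi>" "bij \<phi>" using assms by auto
  define \<psi> where "\<psi> = psubst (\<lambda>i. abel (\<phi> (fvar i)))"
  define \<psi>' where "\<psi>' = psubst (\<lambda>i. abel (inv_into UNIV \<phi> (fvar i)))"
  have c: "\<psi> (abel p) = abel (\<phi> p)" "\<psi>' (abel p) = abel (inv_into UNIV \<phi> p)" for p
    using psubst_abel[OF \<phi>(1)] psubst_abel[OF alg_hom_inv[OF \<phi>]]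
    by (auto simp: \<psi>_def \<psi>'_def fun_eq_iff)
  have "\<psi>' (\<psi> q) = q" "\<psi> (\<psi>' q) = q" for q
  proof -
    obtain p where q: "q = abel p" using surj_abel by (metis surjD)
    show "\<psi>' (\<psi> q) = q" "\<psi> (\<psi>' q) = q"
      using \<phi>(2) by (simp_all add: q c bij_is_inj bij_is_surj surj_f_inv_f)
  qed
  then have "bij \<psi>" by (intro o_bij[of \<psi>' \<psi>]) (auto simp: fun_eq_iff)
  then show "\<exists>\<psi>. \<psi> \<in> carrier Aut_poly \<and> \<psi> \<circ> abel = abel \<circ> \<phi>"
    using c alg_hom_psubst by (intro exI[of _ \<psi>]) (auto simp: fun_eq_iff \<psi>_def)
next
  fix \<psi> \<psi>' :: "('v, 'a) pring \<Rightarrow> ('v, 'a) pring"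
  assume "\<psi> \<in> carrier Aut_poly \<and> \<psi> \<circ> abel = abel \<circ> \<phi>"
    and "\<psi>' \<in> carrier Aut_poly \<and> \<psi>' \<circ> abel = abel \<circ> \<phi>"
  then have "\<psi> (abel p) = \<psi>' (abel p)" for p by (metis comp_apply)
  moreover have "\<exists>p. q = abel p" for q :: "('v, 'a) pring" using surj_abel by (rule surjD)
  ultimately show "\<psi> = \<psi>'" by (metis ext)
qed

lemma abel_aut:
  fixes \<phi> :: "('v::finite, 'a::field) free_alg \<Rightarrow> ('v, 'a) free_alg"
  assumes "\<phi> \<in> carrier Aut_free"
  shows "abel_aut \<phi> \<in> carrier Aut_poly" "abel_aut \<phi> \<circ> abel = abel \<circ> \<phi>"
  using theI'[OF abel_aut_unique_existence[OF assms]] unfolding abel_aut_def by blast+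

lemma abel_aut_hom:
  "abel_aut \<in> hom (Aut_free :: (('v::finite, 'a::field) free_alg \<Rightarrow> _) monoid) Aut_poly"
proof (rule homI)
  fix f g :: "('v, 'a) free_alg \<Rightarrow> ('v, 'a) free_alg"
  assume fg: "f \<in> carrier Aut_free" "g \<in> carrier Aut_free"
  have "f \<otimes>\<^bsub>Aut\<^esub> g \<in> carrier Aut_free"
    using group.is_monoid[OF group_Aut] fg by (rule monoid.m_closed)
  note * = abel_aut[OF this]
  have "abel_aut (f \<otimes>\<^bsub>Aut\<^esub> g) q = abel_aut f (abel_aut g q)" for q
  proof -
    obtain p where q: "q = abel p" using surj_abel by (metis surjD)
    show ?thesis
      using *(2) abel_aut(2)[OF fg(1)] abel_aut(2)[OF fg(2)] by (simp add: q fun_eq_iff)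
  qed
  then show "abel_aut (f \<otimes>\<^bsub>Aut\<^esub> g) = abel_aut f \<otimes>\<^bsub>Aut\<^esub> abel_aut g"
    by (simp add: fun_eq_iff)
qed (rule abel_aut)

end

(*
  Let s be a section of the abelianization over a group G. Modulo cubic terms, conjugation by s g
  depends only on the linear part of g, so the quadratic part of s g inherits every linear symmetry
  of g. For three distinct variables x, y, z:

  - x |-> x + yz commutes with swapping y and z, so yz and zy have the same coefficient in the
    lifted image of x; these coefficients sum to 1, which is impossible in characteristic 2.

  - If 2 is invertible, x |-> x + c z^2 commutes with all sign changes of variables other than x and
    with x |-> x + z, which forces its lift to be x |-> x + c z^2 modulo cubic terms. Hence the
    commutators of such maps have known lifts modulo quartic terms: x |-> x + 4c z y^2 lifts to
    x |-> x + 2c (zyy + yyz). Substituting y + z and y - z for y gives two maps that differ by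
    x |-> x + 16 y z^2; the coefficients of zyz in their lifts are 4 and -4, while it is 0 in the
    lift of the difference. So 8 = 0, a contradiction.

  All the maps used are tame and fix the origin, hence lie in both groups of the theorem.
*)

theory Submission
  imports Defs
begin

section \<open>The degree filtration\<close>

abbreviation cst :: "'a \<Rightarrow> ('m::zero \<Rightarrow>\<^sub>0 'a::zero)"
  where "cst \<equiv> Poly_Mapping.single 0"

text \<open>The \<open>k\<close>-th power of the augmentation ideal of the free algebra. Congruence
  modulo terms of degree at least \<open>k\<close> is expressed as \<open>p - q \<in> fil k\<close>
  throughout.\<close>

definition fil :: "nat \<Rightarrow> ('v, 'a::field) free_alg set"
  where "fil k = {p. \<forall>w\<in>Poly_Mapping.keys p. k \<le> length (letters w)}"

lemma filD: "p \<in> fil k \<Longrightarrow> length (letters w) < k \<Longrightarrow> Poly_Mapping.lookup p w = 0"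
  by (force simp: fil_def in_keys_iff)

lemma filI: "(\<And>w. length (letters w) < k \<Longrightarrow> Poly_Mapping.lookup p w = 0) \<Longrightarrow> p \<in> fil k"
  by (force simp: fil_def in_keys_iff)

lemma fil_lookup: "p - q \<in> fil k \<Longrightarrow> length (letters w) < k \<Longrightarrow>
    Poly_Mapping.lookup p w = Poly_Mapping.lookup q w"
  using filD[of "p - q" k w] by (simp add: lookup_minus)

lemma fil_0 [simp]: "0 \<in> fil k" "p \<in> fil 0"
  by (simp_all add: fil_def)

lemma fil_add: "p \<in> fil k \<Longrightarrow> q \<in> fil k \<Longrightarrow> p + q \<in> fil k"
  by (rule filI) (simp add: filD lookup_add)

lemma fil_diff: "p \<in> fil k \<Longrightarrow> q \<in> fil k \<Longrightarrow> p - q \<in> fil k"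
  by (rule filI) (simp add: filD lookup_minus)

lemma fil_uminus: "p \<in> fil k \<Longrightarrow> - p \<in> fil k"
  by (rule filI) (simp add: filD)

lemma fil_sum: "(\<And>x. x \<in> A \<Longrightarrow> f x \<in> fil k) \<Longrightarrow> sum f A \<in> fil k"
  by (induction A rule: infinite_finite_induct) (simp_all add: fil_add)

lemma fil_mono: "p \<in> fil k \<Longrightarrow> j \<le> k \<Longrightarrow> p \<in> fil j"
  by (force simp: fil_def)

lemma fil_of_diff: "p - q \<in> fil m \<Longrightarrow> q \<in> fil k \<Longrightarrow> k \<le> m \<Longrightarrow> p \<in> fil k"
  using fil_add[OF fil_mono[of "p - q" m k], of q] by simp

lemma fil_diff_cancel: "p \<in> fil k \<Longrightarrow> p - q \<in> fil k \<Longrightarrow> q \<in> fil k"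
  using fil_diff[of p k "p - q"] by simp

lemma fil_diff_swap: "p - q \<in> fil k \<Longrightarrow> p - r \<in> fil k \<Longrightarrow> q - r \<in> fil k"
  using fil_diff[of "p - r" k "p - q"] by simp

lemma letters_add: "letters (u + v) = letters u @ letters v"
  by (simp add: plus_fword_def)

lemma fil_mult: "p \<in> fil j \<Longrightarrow> q \<in> fil k \<Longrightarrow> n \<le> j + k \<Longrightarrow> p * q \<in> fil n"
  using keys_mult[of p q] by (fastforce simp: fil_def letters_add)

lemma fil_cst: "p \<in> fil k \<Longrightarrow> cst c * p \<in> fil k"
  by (rule fil_mult[of _ 0 _ k]) simp_all

lemma fil_fvar: "fvar i \<in> fil (Suc 0)"
  by (simp add: fil_def fvar_def)

text \<open>Words at least as long as \<open>u\<close> and \<open>v\<close> can concatenate to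
  \<open>u + v\<close> only if they are \<open>u\<close> and \<open>v\<close> themselves. Hence
  exactly one pair of terms contributes, and lowest-degree coefficients are multiplicative.\<close>

lemma lookup_fil_mult:
  fixes p q :: "('v, 'a::field) free_alg"
  assumes p: "p \<in> fil (length (letters u))" and q: "q \<in> fil (length (letters v))"
  shows "Poly_Mapping.lookup (p * q) (u + v) = Poly_Mapping.lookup p u * Poly_Mapping.lookup q v"
proof -
  let ?P = "\<lambda>a. Poly_Mapping.single a (Poly_Mapping.lookup p a)"
  let ?Q = "\<lambda>b. Poly_Mapping.single b (Poly_Mapping.lookup q b)"
  have *: "a + b = u + v \<longleftrightarrow> a = u \<and> b = v"
    if "a \<in> Poly_Mapping.keys p" "b \<in> Poly_Mapping.keys q" for a b
  proof
    assume "a + b = u + v"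
    then have eq: "letters a @ letters b = letters u @ letters v" by (metis letters_add)
    have "length (letters u) \<le> length (letters a)" "length (letters v) \<le> length (letters b)"
      using p q that by (auto simp: fil_def)
    with arg_cong[OF eq, of length] have "length (letters u) = length (letters a)" by simp
    with eq show "a = u \<and> b = v" by (simp add: fword.expand)
  qed simp
  have "Poly_Mapping.lookup (p * q) (u + v) =
      Poly_Mapping.lookup (sum ?P (Poly_Mapping.keys p) * sum ?Q (Poly_Mapping.keys q)) (u + v)"
    by (simp only: pm_expand[symmetric])
  also have "\<dots> = (\<Sum>a\<in>Poly_Mapping.keys p. \<Sum>b\<in>Poly_Mapping.keys q.
      (if a = u \<and> b = v then Poly_Mapping.lookup p a * Poly_Mapping.lookup q b else 0))"
    by (simp add: sum_product lookup_sum mult_single lookup_single when_def * cong: sum.cong)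
  also have "\<dots> = (\<Sum>a\<in>Poly_Mapping.keys p. if a = u then
      (\<Sum>b\<in>Poly_Mapping.keys q. if b = v then Poly_Mapping.lookup p a * Poly_Mapping.lookup q b else 0)
      else 0)"
    by (intro sum.cong refl) simp
  also have "\<dots> = Poly_Mapping.lookup p u * Poly_Mapping.lookup q v"
    by (simp add: sum.delta in_keys_iff)
  finally show ?thesis .
qed

lemma lookup_mult_11:
  assumes "p \<in> fil (Suc 0)" "q \<in> fil (Suc 0)"
  shows "Poly_Mapping.lookup (p * q) (Word [j, k]) =
    Poly_Mapping.lookup p (Word [j]) * Poly_Mapping.lookup q (Word [k])"
  using lookup_fil_mult[of p "Word [j]" q "Word [k]"] assms by (simp add: plus_fword_def)

lemma lookup_mult_111:
  assumes "p \<in> fil (Suc 0)" "q \<in> fil (Suc 0)" "r \<in> fil (Suc 0)"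
  shows "Poly_Mapping.lookup (p * q * r) (Word [i, j, k]) = Poly_Mapping.lookup p (Word [i]) *
    Poly_Mapping.lookup q (Word [j]) * Poly_Mapping.lookup r (Word [k])"
  using lookup_fil_mult[of "p * q" "Word [i, j]" r "Word [k]"] fil_mult[OF assms(1,2), of 2] assms(3)
  by (simp add: plus_fword_def lookup_mult_11 assms(1,2) numeral_2_eq_2)

lemma lookup_fvar: "Poly_Mapping.lookup (fvar i) (Word [j]) = (if i = j then 1 else 0)"
  by (simp add: fvar_def lookup_single when_def)

lemma lookup_cst_mult: 
  fixes p :: "('v, 'a::field) free_alg"
  shows "Poly_Mapping.lookup (cst c * p) w = c * Poly_Mapping.lookup p w"
proof -
  have "(cst c * p) = (\<Sum>v\<in>Poly_Mapping.keys p. Poly_Mapping.single v (c * Poly_Mapping.lookup p v))"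
    by (subst pm_expand[of p]) (simp add: sum_distrib_left mult_single)
  then show ?thesis
    by (simp add: lookup_sum lookup_single when_def in_keys_iff sum.delta)
qed

lemma fil_expand:
  fixes p :: "('v::finite, 'a::field) free_alg"
  assumes "p \<in> fil 2"
  shows "p - (\<Sum>i\<in>UNIV. \<Sum>j\<in>UNIV. cst (Poly_Mapping.lookup p (Word [i, j])) * (fvar i * fvar j)) \<in> fil 3"
proof (rule filI)
  fix w :: "'v fword"
  assume w: "length (letters w) < 3"
  have f2: "cst c * (fvar i * fvar j) \<in> fil 2" for c :: 'a and i j :: 'v
    by (intro fil_cst fil_mult[of _ "Suc 0" _ "Suc 0"] fil_fvar) simp
  show "Poly_Mapping.lookup (p - (\<Sum>i\<in>UNIV. \<Sum>j\<in>UNIV.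
      cst (Poly_Mapping.lookup p (Word [i, j])) * (fvar i * fvar j))) w = 0"
  proof (cases "length (letters w) < 2")
    case True
    then show ?thesis
      by (intro filD[OF _ True] fil_diff assms fil_sum f2)
  next
    case False
    with w have "length (letters w) = 2" by simp
    then obtain a b where ab: "letters w = [a, b]"
      by (auto simp: numeral_2_eq_2 length_Suc_conv)
    have w: "w = Word [a, b]" using ab by (cases w) simp
    \<comment> \<open>Nested conditionals are the shape in which the two sums collapse one after the
      other.\<close>
    have delta: "c * ((if P then 1 else 0) * (if Q then 1 else 0)) = (if Q then if P then c else 0 else 0)"
      for c :: 'a and P Q by simp
    show ?thesis
      by (simp add: w lookup_minus lookup_sum lookup_cst_mult lookup_mult_11[OF fil_fvar fil_fvar]
          lookup_fvar delta)
  qed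
qed

section \<open>Homomorphisms of the free algebra\<close>

lemma alg_hom_diff: "alg_hom f \<Longrightarrow> f (p - q) = f p - f q"
  using alg_homD(1)[of f "p - q" q] by simp

lemma alg_hom_uminus: "alg_hom f \<Longrightarrow> f (- p) = - f p"
  using alg_hom_diff[of f 0 p] by (simp add: alg_homD)

lemma alg_hom_numeral: "alg_hom f \<Longrightarrow> f (numeral n) = numeral n"
  using alg_homD(3)[of f "numeral n"] by simp

text \<open>Induction along a word with the telescoping \<open>f x * f w - g x * g w = (f x - g x) *
  f w + g x * (f w - g w)\<close>: replacing one letter at a time costs one factor of degree 1 and
  gains one of degree \<open>Suc m\<close>.\<close>

lemma fil_hom_diff:
  fixes f g :: "('v, 'a::field) free_alg \<Rightarrow> ('v, 'a) free_alg"
  assumes f: "alg_hom f" and g: "alg_hom g"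
    and f1: "\<And>i. f (fvar i) \<in> fil (Suc 0)" and g1: "\<And>i. g (fvar i) \<in> fil (Suc 0)"
    and fg: "\<And>i. f (fvar i) - g (fvar i) \<in> fil (Suc m)"
    and p: "p \<in> fil k"
  shows "f p - g p \<in> fil (k + m)"
proof -
  have word: "f (Poly_Mapping.single (Word xs) 1) \<in> fil (length xs) \<and>
      f (Poly_Mapping.single (Word xs) 1) - g (Poly_Mapping.single (Word xs) 1) \<in> fil (length xs + m)" for xs
  proof (induction xs)
    case Nil
    have "Poly_Mapping.single (Word []) 1 = (1 :: ('v, 'a) free_alg)" by (simp flip: zero_fword_def)
    then show ?case by (simp add: alg_homD[OF f] alg_homD[OF g])
  next
    case (Cons x xs)
    let ?w = "Poly_Mapping.single (Word xs) (1 :: 'a)"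
    have *: "Poly_Mapping.single (Word (x # xs)) (1 :: 'a) = fvar x * ?w"
      by (simp add: fvar_def mult_single plus_fword_def)
    have "f (fvar x) * f ?w \<in> fil (length (x # xs))"
      by (rule fil_mult[OF f1[of x]]) (use Cons in auto)
    have "f (fvar x) * f ?w - g (fvar x) * g ?w =
        (f (fvar x) - g (fvar x)) * f ?w + g (fvar x) * (f ?w - g ?w)"
      by (simp add: algebra_simps)
    also have "\<dots> \<in> fil (length (x # xs) + m)"
      by (intro fil_add fil_mult[OF fg[of x]] fil_mult[OF g1[of x]])
         (use Cons in auto)
    finally show ?case using \<open>_ \<in> fil (length (x # xs))\<close>
      by (simp only: * alg_homD(2)[OF f] alg_homD(2)[OF g] simp_thms)
  qed
  have single: "Poly_Mapping.single w c = cst c * Poly_Mapping.single w 1" for w :: "'v fword" and c :: 'a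
    by (simp add: mult_single)
  have "f (Poly_Mapping.single w c) - g (Poly_Mapping.single w c) \<in> fil (k + m)"
    if "k \<le> length (letters w)" for w c
  proof -
    have "f (Poly_Mapping.single w 1) - g (Poly_Mapping.single w 1) \<in> fil (k + m)"
      using word[of "letters w"] that by (auto intro: fil_mono)
    from fil_cst[OF this, of c] show ?thesis
      by (subst (1 2) single) (simp only: alg_homD[OF f] alg_homD[OF g] right_diff_distrib)
  qed
  then have "(\<Sum>w\<in>Poly_Mapping.keys p. f (Poly_Mapping.single w (Poly_Mapping.lookup p w)) -
      g (Poly_Mapping.single w (Poly_Mapping.lookup p w))) \<in> fil (k + m)"
    using p by (intro fil_sum) (auto simp: fil_def)
  then have "f (\<Sum>w\<in>Poly_Mapping.keys p. Poly_Mapping.single w (Poly_Mapping.lookup p w)) -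
      g (\<Sum>w\<in>Poly_Mapping.keys p. Poly_Mapping.single w (Poly_Mapping.lookup p w)) \<in> fil (k + m)"
    by (simp only: alg_hom_sum[OF f] alg_hom_sum[OF g] sum_subtractf)
  then show ?thesis by (simp flip: pm_expand)
qed

text \<open>Source of the error estimates below: a map that agrees with the identity up to degree
  \<open>m\<close> on the variables moves an element of order \<open>k\<close> only in degrees at
  least \<open>k + m\<close>. The slack in \<open>n\<close> lets numerals be inserted
  directly.\<close>

lemma fil_hom_minus_id:
  fixes f :: "('v, 'a::field) free_alg \<Rightarrow> ('v, 'a) free_alg"
  assumes "alg_hom f" "\<And>i. f (fvar i) - fvar i \<in> fil (Suc m)" "p \<in> fil k" "n \<le> k + m"
  shows "f p - p \<in> fil n"
proof -
  have "f (fvar i) \<in> fil (Suc 0)" for i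
    using fil_add[OF fil_mono[OF assms(2)[of i]] fil_fvar[of i]] by simp
  then have "f p - id p \<in> fil (k + m)"
    using assms(2) fil_fvar by (intro fil_hom_diff[OF assms(1) alg_hom_id _ _ _ assms(3)]) auto
  then show ?thesis using assms(4) by (auto intro: fil_mono)
qed

lemma fil_hom:
  fixes f :: "('v, 'a::field) free_alg \<Rightarrow> ('v, 'a) free_alg"
  assumes "alg_hom f" "\<And>i. f (fvar i) \<in> fil (Suc 0)" "p \<in> fil k"
  shows "f p \<in> fil k"
proof -
  have "f p - p \<in> fil k"
    \<comment> \<open>For \<open>m = 0\<close>, being close to the identity only means having no
      constant terms.\<close>
    by (rule fil_hom_minus_id[OF assms(1) _ assms(3), of 0])
       (use fil_diff[OF assms(2) fil_fvar] in auto)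
  then show ?thesis using fil_add[of "f p - p" k p] assms by simp
qed

text \<open>Modulo cubic terms only the quadratic part of \<open>p\<close> and the linear part of
  \<open>f\<close> matter, and the former transforms like the matrix of a bilinear form.\<close>

lemma lookup_hom_fil_2:
  fixes f :: "('v::finite, 'a::field) free_alg \<Rightarrow> ('v, 'a) free_alg"
  assumes f: "alg_hom f" and f1: "\<And>i. f (fvar i) \<in> fil (Suc 0)" and p: "p \<in> fil 2"
  shows "Poly_Mapping.lookup (f p) (Word [j, k]) = (\<Sum>a\<in>UNIV. \<Sum>b\<in>UNIV.
    Poly_Mapping.lookup p (Word [a, b]) * (Poly_Mapping.lookup (f (fvar a)) (Word [j]) *
      Poly_Mapping.lookup (f (fvar b)) (Word [k])))"
proof -
  have "f (p - (\<Sum>a\<in>UNIV. \<Sum>b\<in>UNIV. cst (Poly_Mapping.lookup p (Word [a, b])) * (fvar a * fvar b)))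
      \<in> fil 3"
    by (intro fil_hom[OF f f1] fil_expand p)
  then have "f p - (\<Sum>a\<in>UNIV. \<Sum>b\<in>UNIV. cst (Poly_Mapping.lookup p (Word [a, b])) * (f (fvar a) * f (fvar b)))
      \<in> fil 3"
    by (simp add: alg_hom_diff[OF f] alg_hom_sum[OF f] alg_homD[OF f])
  from fil_lookup[OF this, of "Word [j, k]"] show ?thesis
    by (simp add: lookup_sum lookup_cst_mult lookup_mult_11 f1)
qed

section \<open>Low-degree coefficients of the abelianization\<close>

lemma exponents_eq_iff: "exponents u = exponents v \<longleftrightarrow> mset (letters u) = mset (letters v)"
proof -
  have "Poly_Mapping.lookup (\<Sum>i\<leftarrow>xs. Poly_Mapping.single i 1) = (count (mset xs) :: 'a \<Rightarrow> nat)" for xs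
    by (induction xs) (auto simp: lookup_add lookup_single when_def)
  then show ?thesis
    by (simp add: exponents_def poly_mapping_eq_iff multiset_eq_iff fun_eq_iff)
qed

text \<open>\<open>A\<close> is the fibre of \<open>exponents\<close> over \<open>m\<close>; it is
  computed below for words of length at most two.\<close>

lemma lookup_abel:
  assumes "finite A" "\<And>w. exponents w = m \<longleftrightarrow> w \<in> A"
  shows "Poly_Mapping.lookup (abel p) m = (\<Sum>w\<in>A. Poly_Mapping.lookup p w)"
proof -
  have "Poly_Mapping.lookup (abel p) m =
      (\<Sum>w\<in>Poly_Mapping.keys p. if w \<in> A then Poly_Mapping.lookup p w else 0)"
    by (simp add: abel_def lookup_sum lookup_single when_def assms(2))
  also have "\<dots> = (\<Sum>w\<in>A. Poly_Mapping.lookup p w)"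
    using assms(1) by (simp flip: sum.inter_restrict, intro sum.mono_neutral_left) (auto simp: in_keys_iff)
  finally show ?thesis .
qed

lemma lookup_abel_0: "Poly_Mapping.lookup (abel p) (exponents (Word [])) = Poly_Mapping.lookup p (Word [])"
proof -
  have "exponents w = exponents (Word []) \<longleftrightarrow> w \<in> {Word []}" for w
    by (cases w) (auto simp: exponents_eq_iff)
  from lookup_abel[OF _ this] show ?thesis by simp
qed

lemma lookup_abel_1: "Poly_Mapping.lookup (abel p) (exponents (Word [i])) = Poly_Mapping.lookup p (Word [i])"
proof -
  have "exponents w = exponents (Word [i]) \<longleftrightarrow> w \<in> {Word [i]}" for w
    by (cases w) (auto simp: exponents_eq_iff)
  from lookup_abel[OF _ this] show ?thesis by simp
qed

lemma lookup_abel_2: "Poly_Mapping.lookup (abel p) (exponents (Word [i, j])) =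
    (if i = j then Poly_Mapping.lookup p (Word [i, j])
     else Poly_Mapping.lookup p (Word [i, j]) + Poly_Mapping.lookup p (Word [j, i]))"
proof -
  have "exponents w = exponents (Word [i, j]) \<longleftrightarrow> w \<in> {Word [i, j], Word [j, i]}" for w
  proof (cases w)
    case (Word xs)
    have "mset xs = {#i, j#} \<Longrightarrow> xs = [i, j] \<or> xs = [j, i]"
    proof -
      assume *: "mset xs = {#i, j#}"
      then have "length xs = 2" by (metis size_mset size_add_mset size_empty numeral_2_eq_2)
      then obtain a b where "xs = [a, b]" by (auto simp: numeral_2_eq_2 length_Suc_conv)
      with * show ?thesis by (auto simp: add_eq_conv_ex)
    qed
    then show ?thesis using Word by (auto simp: exponents_eq_iff)
  qed
  from lookup_abel[OF _ this] show ?thesis by auto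
qed

section \<open>Elementary and linear automorphisms of the polynomial ring\<close>

lemma alg_hom_poly_eqI:
  fixes f g :: "('v, 'a::field) pring \<Rightarrow> ('k::monoid_add \<Rightarrow>\<^sub>0 'a)"
  assumes "alg_hom f" "alg_hom g" "\<And>i. f (pvar i) = g (pvar i)"
  shows "f = g"
proof
  fix q :: "('v, 'a) pring"
  have "f \<circ> abel = g \<circ> abel"
    by (rule alg_hom_free_eqI) (simp_all add: alg_hom_comp alg_hom_abel assms abel_fvar)
  moreover obtain p :: "('v, 'a) free_alg" where "q = abel p" using surj_abel by (metis surjD)
  ultimately show "f q = g q" by (metis comp_apply)
qed

lemma psubst_eq: "alg_hom f \<Longrightarrow> (\<And>i. f (pvar i) = \<sigma> i) \<Longrightarrow> psubst \<sigma> = f"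
  by (rule alg_hom_poly_eqI) (simp_all add: alg_hom_psubst psubst_pvar)

lemma not_involving_intros:
  "not_involving i 0"
  "not_involving i P \<Longrightarrow> not_involving i Q \<Longrightarrow> not_involving i (P + Q)"
  "not_involving i P \<Longrightarrow> not_involving i Q \<Longrightarrow> not_involving i (P - Q)"
  "not_involving i P \<Longrightarrow> not_involving i (- P)"
  "not_involving i P \<Longrightarrow> not_involving i Q \<Longrightarrow> not_involving i (P * Q)"
  "not_involving i (cst c)"
  "i \<noteq> j \<Longrightarrow> not_involving i (pvar j)"
proof -
  show add: "not_involving i P \<Longrightarrow> not_involving i Q \<Longrightarrow> not_involving i (P + Q)" for P Q
    using Poly_Mapping.keys_add[of P Q] by (auto simp: not_involving_def)
  show uminus: "not_involving i P \<Longrightarrow> not_involving i (- P)" for P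
    by (auto simp: not_involving_def)
  show "not_involving i P \<Longrightarrow> not_involving i Q \<Longrightarrow> not_involving i (P - Q)" for P Q
    using add[of P "- Q"] uminus[of Q] by simp
  show "not_involving i P \<Longrightarrow> not_involving i Q \<Longrightarrow> not_involving i (P * Q)" for P Q
    using keys_mult[of P Q] by (fastforce simp: not_involving_def lookup_add)
  show "not_involving i 0" "not_involving i (cst c)"
    by (auto simp: not_involving_def)
  show "i \<noteq> j \<Longrightarrow> not_involving i (pvar j)"
    by (auto simp: not_involving_def pvar_def lookup_single)
qed

text \<open>The image of variable \<open>i\<close> enters only with exponent 0, so \<open>f\<close>
  substitutes as the identity does.\<close>

lemma alg_hom_fixes_not_involving:
  fixes f :: "('v::finite, 'a::field) pring \<Rightarrow> ('v, 'a) pring"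
  assumes f: "alg_hom f" and fixes_others: "\<And>j. j \<noteq> i \<Longrightarrow> f (pvar j) = pvar j" and P: "not_involving i P"
  shows "f P = P"
proof -
  have "psubst (\<lambda>j. f (pvar j)) P = psubst pvar P"
    unfolding psubst_def mon_ext_def
    by (intro sum.cong refl arg_cong2[where f = "(*)"] prod.cong)
       (use P fixes_others in \<open>metis not_involving_def power_0\<close>)
  then show ?thesis by (simp add: psubst_eq[OF f] psubst_eq[OF alg_hom_id])
qed

definition elem_aut :: "'v \<Rightarrow> ('v::finite, 'a::field) pring \<Rightarrow> ('v, 'a) pring \<Rightarrow> ('v, 'a) pring"
  where "elem_aut i P = psubst (\<lambda>j. if j = i then pvar i + P else pvar j)"

lemma alg_hom_elem_aut: "alg_hom (elem_aut i P)"
  by (simp add: elem_aut_def alg_hom_psubst)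

lemma elem_aut_pvar: "elem_aut i P (pvar j) = (if j = i then pvar i + P else pvar j)"
  by (simp add: elem_aut_def psubst_pvar)

lemmas elem_aut_simps = elem_aut_pvar alg_homD[OF alg_hom_elem_aut] alg_hom_diff[OF alg_hom_elem_aut]
  alg_hom_uminus[OF alg_hom_elem_aut] alg_hom_numeral[OF alg_hom_elem_aut]

text \<open>\<open>elem_aut i P\<close> fixes \<open>Q\<close>, because \<open>Q\<close> does not
  involve the only variable that is moved. In particular \<open>elem_aut i (- P)\<close> is the
  inverse of \<open>elem_aut i P\<close> when \<open>P\<close> does not involve
  \<open>i\<close>.\<close>

lemma elem_aut_add: "not_involving i Q \<Longrightarrow> elem_aut i P \<circ> elem_aut i Q = elem_aut i (P + Q)"
proof (rule alg_hom_poly_eqI)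
  assume "not_involving i Q"
  then have "elem_aut i P Q = Q"
    by (rule alg_hom_fixes_not_involving[OF alg_hom_elem_aut, rotated]) (simp add: elem_aut_pvar)
  then show "(elem_aut i P \<circ> elem_aut i Q) (pvar j) = elem_aut i (P + Q) (pvar j)" for j
    by (simp add: elem_aut_simps add_ac)
qed (simp_all add: alg_hom_comp alg_hom_elem_aut)

lemma elem_aut_0: "elem_aut i 0 = id"
  unfolding elem_aut_def by (rule psubst_eq) (simp_all add: alg_hom_id)

lemma elem_aut_elementary:
  assumes "not_involving i P"
  shows "elem_aut i P \<in> elementary_auts"
proof -
  have "elem_aut i P \<circ> elem_aut i (- P) = id" "elem_aut i (- P) \<circ> elem_aut i P = id"
    using assms by (simp_all add: elem_aut_add elem_aut_0 not_involving_intros)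
  then have "bij (elem_aut i P)" by (rule o_bij[rotated])
  with assms show ?thesis
    by (auto simp: elementary_auts_def alg_hom_elem_aut elem_aut_pvar)
qed

section \<open>The augmentation ideal and automorphisms fixing the origin\<close>

lemma ring_of_type_algebra_simps [simp]:
  "carrier ring_of_type_algebra = UNIV"
  "monoid.mult ring_of_type_algebra = (*)" "ring.add ring_of_type_algebra = (+)"
  "monoid.one ring_of_type_algebra = 1" "ring.zero ring_of_type_algebra = 0"
  by (simp_all add: ring_of_type_algebra_def)

lemma ideal_aug_ideal: "ideal (aug_ideal :: ('v, 'a::field) pring set) ring_of_type_algebra"
  unfolding aug_ideal_def by (rule ring.genideal_ideal) (simp_all add: ring_from_type_algebra)

lemma aug_ideal_intros:
  "0 \<in> aug_ideal"
  "P \<in> aug_ideal \<Longrightarrow> Q \<in> aug_ideal \<Longrightarrow> P + Q \<in> aug_ideal"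
  "P \<in> aug_ideal \<Longrightarrow> Q \<in> aug_ideal \<Longrightarrow> P - Q \<in> aug_ideal"
  "P \<in> aug_ideal \<Longrightarrow> - P \<in> aug_ideal"
  "P \<in> aug_ideal \<Longrightarrow> Q * P \<in> aug_ideal"
  "pvar i \<in> aug_ideal"
proof -
  show zero: "0 \<in> aug_ideal" 
    using additive_subgroup.zero_closed[OF ideal.axioms(1)[OF ideal_aug_ideal]] by simp
  show add: "P \<in> aug_ideal \<Longrightarrow> Q \<in> aug_ideal \<Longrightarrow> P + Q \<in> aug_ideal" for P Q
    using additive_subgroup.a_closed[OF ideal.axioms(1)[OF ideal_aug_ideal]] by simp
  show mult: "P \<in> aug_ideal \<Longrightarrow> Q * P \<in> aug_ideal" for P Q
    using ideal.I_l_closed[OF ideal_aug_ideal] by simp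
  show uminus: "P \<in> aug_ideal \<Longrightarrow> - P \<in> aug_ideal" for P
    using mult[of P "- 1"] by simp
  show "P \<in> aug_ideal \<Longrightarrow> Q \<in> aug_ideal \<Longrightarrow> P - Q \<in> aug_ideal" for P Q
    using add[of P "- Q"] uminus[of Q] by simp
  show "pvar i \<in> aug_ideal"
    using ring.genideal_self[OF ring_from_type_algebra, of "range pvar"]
    by (auto simp: aug_ideal_def)
qed

lemma aug_ideal_sum: "(\<And>x. x \<in> A \<Longrightarrow> f x \<in> aug_ideal) \<Longrightarrow> sum f A \<in> aug_ideal"
  by (induction A rule: infinite_finite_induct) (simp_all add: aug_ideal_intros)

text \<open>Passage to the carrier-based notion of ideal: the additive inverse there is unary minus,
  and commutativity supplies closure under multiplication from the right.\<close>

lemma ideal_of_type_algebraI: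
  fixes I :: "'b::comm_ring_1 set"
  assumes "0 \<in> I" "\<And>p q. p \<in> I \<Longrightarrow> q \<in> I \<Longrightarrow> p + q \<in> I" "\<And>p. p \<in> I \<Longrightarrow> - p \<in> I"
    "\<And>p q. p \<in> I \<Longrightarrow> q * p \<in> I"
  shows "ideal I ring_of_type_algebra"
proof (rule idealI)
  have *: "group (add_monoid (ring_of_type_algebra :: 'b ring))"
    by (rule abelian_group.a_group[OF ring.is_abelian_group[OF ring_from_type_algebra]])
  show "subgroup I (add_monoid ring_of_type_algebra)"
  proof (rule group.subgroupI[OF *])
    show "inv\<^bsub>add_monoid ring_of_type_algebra\<^esub> p \<in> I" if "p \<in> I" for p
    proof -
      have "inv\<^bsub>add_monoid ring_of_type_algebra\<^esub> p = - p"
        by (rule group.inv_equality[OF *]) simp_all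
      then show ?thesis using that assms(3) by simp
    qed
  qed (use assms in auto)
  show "p \<otimes>\<^bsub>ring_of_type_algebra\<^esub> q \<in> I" if "p \<in> I" for p q
    using assms(4)[OF that, of q] by (simp add: mult.commute)
qed (simp_all add: ring_from_type_algebra assms)

text \<open>The preimage of \<open>aug_ideal\<close> under \<open>f\<close> is an ideal, so it
  suffices to test the generators.\<close>

lemma Aut0I:
  fixes f :: "('v, 'a::field) pring \<Rightarrow> ('v, 'a) pring"
  assumes f: "f \<in> carrier Aut_poly" and pvar: "\<And>i. f (pvar i) \<in> aug_ideal"
  shows "f \<in> Aut0"
proof -
  have hom: "alg_hom f" using f by simp
  have "ideal {p. f p \<in> aug_ideal} ring_of_type_algebra"
    by (rule ideal_of_type_algebraI)
       (simp_all add: alg_homD[OF hom] alg_hom_uminus[OF hom] aug_ideal_intros)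
  then have "aug_ideal \<subseteq> {p. f p \<in> aug_ideal}"
    unfolding aug_ideal_def using pvar
    by (intro ring.genideal_minimal) (auto simp: ring_from_type_algebra aug_ideal_def)
  with f show ?thesis by (auto simp: Aut0_def)
qed

section \<open>Tame automorphisms inside the two groups of the theorem\<close>

lemma elementary_in_TAut: "elementary_auts \<subseteq> TAut" and linear_in_TAut: "linear_auts \<subseteq> TAut"
  by (auto simp: TAut_def intro: generate.incl)

lemma subgroup_TAut: "subgroup TAut Aut_poly"
  unfolding TAut_def
  by (rule group.generate_is_subgroup[OF group_Aut])
     (auto simp: linear_auts_def elementary_auts_def)

text \<open>A tame automorphism approximates itself to every order: the factor tangent to the
  identity is \<open>id\<close>, whose displacement 0 lies in every power of the ideal.\<close>

lemma TAut_subset_NAut: "TAut \<subseteq> (NAut :: (('v::finite, 'a::field) pring \<Rightarrow> _) set)"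
proof
  fix f :: "('v, 'a) pring \<Rightarrow> ('v, 'a) pring"
  assume f: "f \<in> TAut"
  have "0 \<in> (aug_ideal_power m :: ('v, 'a) pring set)" for m
  proof (induction m)
    case (Suc m)
    from ideal_prod.prod[OF this aug_ideal_intros(1), of ring_of_type_algebra] show ?case
      by (simp add: aug_ideal_power_def ideals_set_def nat_pow_def)
  qed (simp add: aug_ideal_power_def ideals_set_def nat_pow_def)
  then show "f \<in> NAut"
    using f subgroup.subset[OF subgroup_TAut]
    unfolding NAut_def
    by (intro CollectI conjI allI bexI[of _ id] bexI[of _ f]) (auto simp: alg_hom_id)
qed

lemma linear_in_Aut0: "linear_auts \<subseteq> Aut0"
  by (rule subsetI, rule Aut0I) (auto simp: linear_auts_def intro!: aug_ideal_sum aug_ideal_intros)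

lemma elem_aut_in_Aut0:
  assumes "not_involving i P" "P \<in> aug_ideal"
  shows "elem_aut i P \<in> Aut0"
  using elem_aut_elementary[OF assms(1)] assms(2)
  by (intro Aut0I) (auto simp: elementary_auts_def elem_aut_pvar intro!: aug_ideal_intros)

lemma comp_in_TAut_Aut0:
  assumes "f \<in> TAut \<inter> Aut0" "g \<in> TAut \<inter> Aut0"
  shows "f \<circ> g \<in> TAut \<inter> Aut0"
proof -
  have "f \<circ> g \<in> TAut"
    using subgroup.m_closed[OF subgroup_TAut, of f g] assms by simp
  moreover from this have "f \<circ> g \<in> carrier Aut_poly" using subgroup.subset[OF subgroup_TAut] by blast
  ultimately show ?thesis using assms by (fastforce simp: Aut0_def)
qed

section \<open>Sign changes and transpositions of variables\<close>

definition flip_aut :: "'v \<Rightarrow> ('v::finite, 'a::field) pring \<Rightarrow> ('v, 'a) pring"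
  where "flip_aut w = psubst (\<lambda>i. if i = w then - pvar w else pvar i)"

definition swap_aut :: "'v \<Rightarrow> 'v \<Rightarrow> ('v::finite, 'a::field) pring \<Rightarrow> ('v, 'a) pring"
  where "swap_aut y z = psubst (\<lambda>i. pvar (if i = y then z else if i = z then y else i))"

lemma alg_hom_flip_swap: "alg_hom (flip_aut w)" "alg_hom (swap_aut y z)"
  by (simp_all add: flip_aut_def swap_aut_def alg_hom_psubst)

lemma flip_aut_pvar: "flip_aut w (pvar i) = (if i = w then - pvar w else pvar i)"
  by (simp add: flip_aut_def psubst_pvar)

lemma swap_aut_pvar: "swap_aut y z (pvar i) = pvar (if i = y then z else if i = z then y else i)"
  by (simp add: swap_aut_def psubst_pvar)

lemmas flip_aut_simps = flip_aut_pvar alg_homD[OF alg_hom_flip_swap(1)] alg_hom_uminus[OF alg_hom_flip_swap(1)]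
lemmas swap_aut_simps = swap_aut_pvar alg_homD[OF alg_hom_flip_swap(2)]

lemma sum_cst_pvar_delta:
  "(\<Sum>j\<in>UNIV. cst (if j = i then c else 0) * pvar j) = (cst c * pvar i :: ('v::finite, 'a::field) pring)"
proof -
  have "cst (if j = i then c else 0) * pvar j = (if j = i then cst c * pvar i else 0 :: ('v, 'a) pring)" for j
    by simp
  then show ?thesis by (simp only: sum.delta[OF finite] UNIV_I if_True)
qed

lemma linear_autsI:
  assumes "alg_hom f" "bij f" "\<And>i. f (pvar i) = (\<Sum>j\<in>UNIV. cst (A i j) * pvar j)"
  shows "f \<in> linear_auts"
  using assms by (auto simp: linear_auts_def)

lemma flip_aut_linear: "(flip_aut w :: ('v::finite, 'a::field) pring \<Rightarrow> _) \<in> linear_auts"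
proof -
  have "flip_aut w \<circ> flip_aut w = (id :: ('v, 'a) pring \<Rightarrow> _)"
    by (rule alg_hom_poly_eqI)
       (simp_all add: alg_hom_comp alg_hom_flip_swap alg_hom_id flip_aut_simps)
  then have "bij (flip_aut w :: ('v, 'a) pring \<Rightarrow> _)" by (metis o_bij)
  moreover have "flip_aut w (pvar i) = (\<Sum>j\<in>UNIV. cst (if j = i then if i = w then - 1 else 1 else 0) * pvar j :: ('v, 'a) pring)" for i
    by (simp add: sum_cst_pvar_delta flip_aut_pvar single_uminus)
  ultimately show ?thesis by (rule linear_autsI[OF alg_hom_flip_swap(1)])
qed

lemma swap_aut_linear: "(swap_aut y z :: ('v::finite, 'a::field) pring \<Rightarrow> _) \<in> linear_auts"
proof -
  have "swap_aut y z \<circ> swap_aut y z = (id :: ('v, 'a) pring \<Rightarrow> _)"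
    by (rule alg_hom_poly_eqI)
       (simp_all add: alg_hom_comp alg_hom_flip_swap alg_hom_id swap_aut_simps)
  then have "bij (swap_aut y z :: ('v, 'a) pring \<Rightarrow> _)" by (metis o_bij)
  moreover have "swap_aut y z (pvar i) = (\<Sum>j\<in>UNIV. cst (if j = (if i = y then z else if i = z then y else i) then 1 else 0) * pvar j :: ('v, 'a) pring)" for i
    by (simp add: sum_cst_pvar_delta swap_aut_pvar)
  ultimately show ?thesis by (rule linear_autsI[OF alg_hom_flip_swap(2)])
qed

section \<open>Sections of the abelianization over the tame group\<close>

text \<open>What the abelianization sees in degrees at most two: everything except how the
  coefficient of a mixed monomial is distributed over its two words.\<close>

lemma abel_eq_coeffs:
  assumes "abel p = abel q"
  shows "Poly_Mapping.lookup p (Word []) = Poly_Mapping.lookup q (Word [])"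
    and "Poly_Mapping.lookup p (Word [i]) = Poly_Mapping.lookup q (Word [i])"
    and "Poly_Mapping.lookup p (Word [i, i]) = Poly_Mapping.lookup q (Word [i, i])"
    and "i \<noteq> j \<Longrightarrow> Poly_Mapping.lookup p (Word [i, j]) + Poly_Mapping.lookup p (Word [j, i]) =
      Poly_Mapping.lookup q (Word [i, j]) + Poly_Mapping.lookup q (Word [j, i])"
  using assms lookup_abel_0[of p] lookup_abel_0[of q] lookup_abel_1[of p i] lookup_abel_1[of q i]
    lookup_abel_2[of p i i] lookup_abel_2[of q i i] lookup_abel_2[of p i j] lookup_abel_2[of q i j]
  by auto

lemma fil_1_iff: "p \<in> fil (Suc 0) \<longleftrightarrow> Poly_Mapping.lookup p (Word []) = 0"
proof
  show "p \<in> fil (Suc 0)" if "Poly_Mapping.lookup p (Word []) = 0"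
  proof (rule filI)
    fix w :: "'a fword"
    assume "length (letters w) < Suc 0"
    then show "Poly_Mapping.lookup p w = 0" using that by (cases w) simp
  qed
qed (simp add: filD)

lemma fil_2_iff: "p \<in> fil 2 \<longleftrightarrow>
    Poly_Mapping.lookup p (Word []) = 0 \<and> (\<forall>i. Poly_Mapping.lookup p (Word [i]) = 0)"
proof
  show "p \<in> fil 2" if *: "Poly_Mapping.lookup p (Word []) = 0 \<and> (\<forall>i. Poly_Mapping.lookup p (Word [i]) = 0)"
  proof (rule filI)
    fix w :: "'a fword"
    assume "length (letters w) < 2"
    then show "Poly_Mapping.lookup p w = 0"
      using * by (cases w; cases "letters w") auto
  qed
qed (simp add: filD)

lemma fil_3I:
  assumes "p \<in> fil 2" "\<And>i j. Poly_Mapping.lookup p (Word [i, j]) = 0"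
  shows "p \<in> fil 3"
proof (rule filI)
  fix w :: "'a fword"
  assume w: "length (letters w) < 3"
  show "Poly_Mapping.lookup p w = 0"
  proof (cases "length (letters w) < 2")
    case True
    then show ?thesis by (rule filD[OF assms(1)])
  next
    case False
    with w have "length (letters w) = 2" by simp
    then obtain i j where "w = Word [i, j]"
      by (cases w) (auto simp: numeral_2_eq_2 length_Suc_conv)
    with assms(2) show ?thesis by simp
  qed
qed

text \<open>Since \<open>abel\<close> is surjective, the image of the ideal
  \<open>fil (Suc 0)\<close> is again an ideal, and it contains the variables.\<close>

lemma aug_ideal_subset: "(aug_ideal :: ('v, 'a::field) pring set) \<subseteq> abel ` fil (Suc 0)"
proof -
  have "ideal (abel ` fil (Suc 0) :: ('v, 'a) pring set) ring_of_type_algebra"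
  proof (rule ideal_of_type_algebraI)
    show "0 \<in> abel ` fil (Suc 0)"
      by (rule image_eqI[of _ _ 0]) (simp_all add: alg_homD[OF alg_hom_abel])
    show "P + Q \<in> abel ` fil (Suc 0)" if PQ: "P \<in> abel ` fil (Suc 0)" "Q \<in> abel ` fil (Suc 0)"
      for P Q :: "('v, 'a) pring"
    proof -
      from PQ obtain p q where "p \<in> fil (Suc 0)" "P = abel p" "q \<in> fil (Suc 0)" "Q = abel q" by blast
      then show ?thesis
        by (intro image_eqI[of _ _ "p + q"]) (simp_all add: alg_homD[OF alg_hom_abel] fil_add)
    qed
    show "- P \<in> abel ` fil (Suc 0)" if P: "P \<in> abel ` fil (Suc 0)" for P :: "('v, 'a) pring"
    proof -
      from P obtain p where "p \<in> fil (Suc 0)" "P = abel p" by blast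
      then show ?thesis
        by (intro image_eqI[of _ _ "- p"]) (simp_all add: alg_hom_uminus[OF alg_hom_abel] fil_uminus)
    qed
    show "Q * P \<in> abel ` fil (Suc 0)" if P: "P \<in> abel ` fil (Suc 0)" for P Q :: "('v, 'a) pring"
    proof -
      from P obtain p where p: "p \<in> fil (Suc 0)" "P = abel p" by blast
      moreover obtain q where "Q = abel q" using surj_abel by (metis surjD)
      ultimately show ?thesis
        by (intro image_eqI[of _ _ "q * p"])
           (simp_all add: alg_homD[OF alg_hom_abel] fil_mult[of _ 0 _ "Suc 0"])
    qed
  qed
  moreover have "range pvar \<subseteq> (abel ` fil (Suc 0) :: ('v, 'a) pring set)"
    using abel_fvar fil_fvar by (metis image_eqI image_subsetI)
  ultimately show ?thesis
    unfolding aug_ideal_def by (rule ring.genideal_minimal[OF ring_from_type_algebra])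
qed

text \<open>Tame automorphisms fixing the origin lie both in \<open>Aut0\<close> and in
  \<open>NAut\<close>, so a contradiction over \<open>TAut0\<close> settles both halves of the
  theorem.\<close>

abbreviation TAut0 :: "(('v::finite, 'a::field) pring \<Rightarrow> ('v, 'a) pring) set"
  where "TAut0 \<equiv> TAut \<inter> Aut0"

lemma elem_aut_in_TAut0:
  "not_involving i P \<Longrightarrow> P \<in> aug_ideal \<Longrightarrow> elem_aut i P \<in> TAut0"
  using elem_aut_elementary elementary_in_TAut elem_aut_in_Aut0 by blast

lemma linear_in_TAut0: "flip_aut w \<in> TAut0" "swap_aut y z \<in> TAut0"
  using flip_aut_linear swap_aut_linear linear_in_TAut linear_in_Aut0 by blast+

lemma mult_delta:
  fixes c :: "'b::semiring_1"
  shows "c * ((if P then 1 else 0) * (if Q then 1 else 0)) = (if Q then if P then c else 0 else 0)"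
    "c * (if Q then if P then 1 else 0 else 0) = (if Q then if P then c else 0 else 0)"
    "(if P then 1 else 0) * c = (if P then c else 0)" "c * (if P then 1 else 0) = (if P then c else 0)"
  by simp_all

lemma lookup_fvar_Nil: "Poly_Mapping.lookup (fvar i) (Word []) = 0"
  by (simp add: fvar_def lookup_single)

text \<open>Without its linear part, \<open>p\<close> has order two and is moved only in degree
  \<open>m + 2\<close>. To leading order the displacement of \<open>p\<close> is therefore the
  linear part of \<open>p\<close> evaluated at the displacements of the variables.\<close>

lemma fil_hom_linear_part:
  fixes f :: "('v::finite, 'a::field) free_alg \<Rightarrow> ('v, 'a) free_alg"
  assumes f: "alg_hom f" and fi: "\<And>i. f (fvar i) - fvar i \<in> fil (Suc m)" and p: "p \<in> fil (Suc 0)"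
  shows "f p - p - (\<Sum>l\<in>UNIV. cst (Poly_Mapping.lookup p (Word [l])) * (f (fvar l) - fvar l))
    \<in> fil (Suc (Suc m))"
proof -
  let ?l = "\<Sum>l\<in>UNIV. cst (Poly_Mapping.lookup p (Word [l])) * fvar l"
  have "p - ?l \<in> fil 2"
    using p by (simp add: fil_2_iff fil_1_iff lookup_minus lookup_sum lookup_cst_mult
        lookup_fvar lookup_fvar_Nil mult_delta)
  then have "f (p - ?l) - (p - ?l) \<in> fil (Suc (Suc m))"
    by (rule fil_hom_minus_id[OF f fi]) simp
  also have "f (p - ?l) - (p - ?l) = f p - p -
      (\<Sum>l\<in>UNIV. cst (Poly_Mapping.lookup p (Word [l])) * (f (fvar l) - fvar l))"
    by (simp add: alg_hom_diff[OF f] alg_hom_sum[OF f] alg_homD[OF f] right_diff_distrib sum_subtractf)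
  finally show ?thesis .
qed

text \<open>A multiplicative lift of \<open>TAut0\<close> to endomorphisms of the free algebra, as
  obtained by inverting \<open>abel_aut\<close> on a subgroup \<open>H\<close>. With three distinct
  variables these assumptions turn out to be contradictory.\<close>

locale abel_section =
  fixes s :: "(('v::finite, 'a::field) pring \<Rightarrow> ('v, 'a) pring) \<Rightarrow> ('v, 'a) free_alg \<Rightarrow> ('v, 'a) free_alg"
  assumes hom: "g \<in> TAut0 \<Longrightarrow> alg_hom (s g)"
    and abel_s: "g \<in> TAut0 \<Longrightarrow> abel (s g (fvar i)) = g (pvar i)"
    and s_comp: "g \<in> TAut0 \<Longrightarrow> h \<in> TAut0 \<Longrightarrow> s (g \<circ> h) = s g \<circ> s h"
begin

abbreviation shift where "shift g i \<equiv> s g (fvar i) - fvar i"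

text \<open>Constant terms are visible to \<open>abel\<close>, so the lift of a map fixing the
  origin has none.\<close>

lemma s_fil_1:
  assumes g: "g \<in> TAut0"
  shows "s g (fvar i) \<in> fil (Suc 0)"
proof -
  have "g ` aug_ideal \<subseteq> aug_ideal" using g by (simp add: Aut0_def)
  then have "g (pvar i) \<in> aug_ideal" by (rule subsetD) (rule imageI[OF aug_ideal_intros(6)])
  then obtain p where "p \<in> fil (Suc 0)" "g (pvar i) = abel p" using aug_ideal_subset by blast
  with abel_eq_coeffs(1)[of "s g (fvar i)" p] show ?thesis
    by (simp add: abel_s[OF g] fil_1_iff)
qed

lemma lookup_s_1:
  "g \<in> TAut0 \<Longrightarrow> g (pvar i) = abel p \<Longrightarrow>
    Poly_Mapping.lookup (s g (fvar i)) (Word [j]) = Poly_Mapping.lookup p (Word [j])"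
  using abel_eq_coeffs(2)[of "s g (fvar i)" p j] by (simp add: abel_s)

text \<open>Coefficients of degree at most one are determined by the abelianization. The polynomial
  is given through a preimage \<open>p\<close>, so that its order can be read off in the free
  algebra.\<close>

lemma shift_fil_2:
  assumes "elem_aut x (abel p) \<in> TAut0" "p \<in> fil 2"
  shows "shift (elem_aut x (abel p)) i \<in> fil 2"
proof -
  have "abel (s (elem_aut x (abel p)) (fvar i)) = abel (fvar i + (if i = x then p else 0))"
    using assms(1) by (simp add: abel_s elem_aut_pvar alg_homD[OF alg_hom_abel] abel_fvar)
  note * = abel_eq_coeffs[OF this]
  show ?thesis unfolding fil_2_iff
  proof (intro conjI allI)
    show "Poly_Mapping.lookup (shift (elem_aut x (abel p)) i) (Word []) = 0"
      using assms(2) by (simp add: lookup_minus *(1) lookup_add fil_2_iff)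
    show "Poly_Mapping.lookup (shift (elem_aut x (abel p)) i) (Word [j]) = 0" for j
      using assms(2) by (simp add: lookup_minus *(2) lookup_add fil_2_iff)
  qed
qed

lemma shift_conj:
  assumes "L \<in> TAut0" "g \<in> TAut0" "g' \<in> TAut0" "L \<circ> g = g' \<circ> L"
  shows "s L (shift g i) = s g' (s L (fvar i)) - s L (fvar i)"
proof -
  have "s L \<circ> s g = s g' \<circ> s L"
    using assms by (metis s_comp)
  then have "s L (s g (fvar i)) = s g' (s L (fvar i))" by (metis comp_apply)
  then show ?thesis using hom[OF assms(1)] by (simp add: alg_hom_diff)
qed

text \<open>To leading order, conjugation by \<open>L\<close> transforms displacements through the
  linear part of \<open>s L\<close> alone on the right-hand side; this part is known from
  \<open>L\<close> by \<open>lookup_s_1\<close>.\<close>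

lemma shift_conj_fil:
  assumes "L \<in> TAut0" "g \<in> TAut0" "g' \<in> TAut0" "L \<circ> g = g' \<circ> L"
    and "\<And>i. shift g' i \<in> fil (Suc m)"
  shows "s L (shift g i) -
    (\<Sum>l\<in>UNIV. cst (Poly_Mapping.lookup (s L (fvar i)) (Word [l])) * shift g' l) \<in> fil (Suc (Suc m))"
  unfolding shift_conj[OF assms(1-4)]
  by (rule fil_hom_linear_part[OF hom[OF assms(3)] assms(5) s_fil_1[OF assms(1)]])

text \<open>Equivariance of the quadratic part of \<open>s g\<close> under the linear part of a
  commuting \<open>L\<close>. The matrix \<open>A\<close> is a parameter so that each use can supply
  its entries in a form that collapses the sums.\<close>

lemma lookup_shift_conj:
  assumes "L \<in> TAut0" "g \<in> TAut0" "L \<circ> g = g \<circ> L" and g2: "\<And>i. shift g i \<in> fil 2"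
    and A: "\<And>i j. A i j = Poly_Mapping.lookup (s L (fvar i)) (Word [j])"
  shows "(\<Sum>l\<in>UNIV. A i l * Poly_Mapping.lookup (shift g l) (Word [j, k])) =
    (\<Sum>a\<in>UNIV. \<Sum>b\<in>UNIV. Poly_Mapping.lookup (shift g i) (Word [a, b]) * (A a j * A b k))"
  using fil_lookup[OF shift_conj_fil[OF assms(1,2,2,3) g2[unfolded numeral_2_eq_2], of i], of "Word [j, k]"]
  by (simp add: lookup_sum lookup_cst_mult A
      lookup_hom_fil_2[OF hom[OF assms(1)] s_fil_1[OF assms(1)] g2])

section \<open>Excluding characteristic two\<close>

lemma char_neq_2:
  fixes x y z :: 'v
  assumes xyz: "x \<noteq> y" "x \<noteq> z" "y \<noteq> z"
  shows "(2 :: 'a) \<noteq> 0"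
proof
  assume two: "(2 :: 'a) = 0"
  define g :: "('v, 'a) pring \<Rightarrow> ('v, 'a) pring" where "g = elem_aut x (pvar y * pvar z)"
  have g: "g \<in> TAut0"
    unfolding g_def using xyz by (intro elem_aut_in_TAut0 not_involving_intros aug_ideal_intros) auto
  have yz: "pvar y * pvar z = abel (fvar y * fvar z :: ('v, 'a) free_alg)"
    by (simp add: alg_homD[OF alg_hom_abel] abel_fvar)
  have fvar2: "fvar y * fvar z \<in> fil 2" by (rule fil_mult[OF fil_fvar fil_fvar]) simp
  have g2: "shift g i \<in> fil 2" for i
    unfolding g_def yz by (rule shift_fil_2[OF _ fvar2]) (use g in \<open>simp only: g_def yz\<close>)
  have comm: "swap_aut y z \<circ> g = g \<circ> swap_aut y z"
    by (rule alg_hom_poly_eqI)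
       (use xyz in \<open>simp_all add: g_def alg_hom_comp alg_hom_flip_swap alg_hom_elem_aut swap_aut_simps
         elem_aut_simps mult.commute\<close>)
  define \<pi> where "\<pi> i = (if i = y then z else if i = z then y else i)" for i
  \<comment> \<open>The linear part of the lifted transposition is the permutation matrix of
    \<open>\<pi>\<close>.\<close>
  have A: "(if j = \<pi> i then 1 else 0) = Poly_Mapping.lookup (s (swap_aut y z) (fvar i)) (Word [j])" for i j
    using lookup_s_1[OF linear_in_TAut0(2), of y z i "fvar (\<pi> i)" j]
    by (simp add: swap_aut_pvar abel_fvar \<pi>_def lookup_fvar)
  have \<pi>: "z = \<pi> a \<longleftrightarrow> a = y" "y = \<pi> a \<longleftrightarrow> a = z" "\<pi> x = x" for a using xyz by (auto simp: \<pi>_def)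
  have "Poly_Mapping.lookup (shift g x) (Word [y, z]) = Poly_Mapping.lookup (shift g x) (Word [z, y])"
    using lookup_shift_conj[OF linear_in_TAut0(2) g comm g2 A, of x y z]
    by (simp add: \<pi> mult_delta)
  moreover have "Poly_Mapping.lookup (shift g x) (Word [y, z]) + Poly_Mapping.lookup (shift g x) (Word [z, y]) = 1"
  proof -
    have "abel (s g (fvar x)) = abel (fvar x + fvar y * fvar z)"
      by (simp add: abel_s[OF g] alg_homD[OF alg_hom_abel] abel_fvar) (simp add: g_def elem_aut_pvar)
    from abel_eq_coeffs(4)[OF this, of y z] show ?thesis
      using xyz by (simp add: lookup_minus lookup_add lookup_mult_11 fil_fvar lookup_fvar algebra_simps)
  qed
  ultimately have "2 * Poly_Mapping.lookup (shift g x) (Word [y, z]) = 1" by simp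
  then show False using two by simp
qed


section \<open>Quadratic parts of lifted squares\<close>

text \<open>The abelianization fixes the diagonal coefficients and makes the others antisymmetric.
  Sign changes then kill all off-diagonal ones except those at the words \<open>ix\<close> and
  \<open>xi\<close> in the image of a variable \<open>i\<close> other than \<open>x\<close>, and
  commutation with the transvection adding \<open>z\<close> to \<open>x\<close> kills these.\<close>

lemma shift_square:
  fixes x z i :: 'v and c :: 'a
  defines "g \<equiv> elem_aut x (cst c * (pvar z * pvar z)) :: ('v, 'a) pring \<Rightarrow> ('v, 'a) pring"
  assumes xz: "x \<noteq> z" and two: "(2 :: 'a) \<noteq> 0"
  shows "shift g i - (if i = x then cst c * (fvar z * fvar z) else 0) \<in> fil 3"
proof -
  have g: "g \<in> TAut0"
    unfolding g_def using xz by (intro elem_aut_in_TAut0 not_involving_intros aug_ideal_intros) auto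
  define q :: "('v, 'a) free_alg" where "q = cst c * (fvar z * fvar z)"
  have abel_q: "cst c * (pvar z * pvar z) = abel q"
    by (simp add: q_def alg_homD[OF alg_hom_abel] abel_fvar)
  have q2: "q \<in> fil 2" unfolding q_def by (intro fil_cst fil_mult[OF fil_fvar fil_fvar]) simp
  have g_eq: "g = elem_aut x (abel q)" by (simp only: g_def abel_q)
  have g2: "shift g i \<in> fil 2" for i
    unfolding g_eq by (rule shift_fil_2[OF _ q2]) (use g in \<open>simp only: g_eq\<close>)
  have lookup_q: "Poly_Mapping.lookup q (Word [j, k]) = (if j = z \<and> k = z then c else 0)" for j k
    by (simp add: q_def lookup_cst_mult lookup_mult_11 fil_fvar lookup_fvar)
  define t where "t i j k = Poly_Mapping.lookup (shift g i) (Word [j, k])" for i j k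
  have abel_eq: "abel (shift g i) = abel (if i = x then q else 0)" for i
    by (simp add: alg_hom_diff[OF alg_hom_abel] abel_s[OF g] alg_homD[OF alg_hom_abel] abel_fvar)
       (simp add: g_eq elem_aut_pvar)
  have t_diag: "t i j j = (if i = x \<and> j = z then c else 0)" for i j
    using abel_eq_coeffs(3)[OF abel_eq, of i j] by (simp add: t_def lookup_q)
  have t_anti: "t i k j = - t i j k" if "j \<noteq> k" for i j k
    using abel_eq_coeffs(4)[OF abel_eq that, of i] that
    by (auto simp: t_def lookup_q eq_neg_iff_add_eq_0 add.commute split: if_splits)
  \<comment> \<open>For \<open>w \<noteq> x\<close> the sign change of \<open>w\<close> commutes
    with \<open>g\<close>, because it fixes \<open>x\<close> and the square of
    \<open>z\<close>.\<close>
  have flip: "(if i = w then - 1 else 1) * t i j k =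
      t i j k * ((if j = w then - 1 else 1) * (if k = w then - 1 else 1))" if "w \<noteq> x" for w i j k
  proof -
    define \<epsilon> :: "'v \<Rightarrow> 'a" where "\<epsilon> i = (if i = w then - 1 else 1)" for i
    have comm: "flip_aut w \<circ> g = g \<circ> flip_aut w"
      by (rule alg_hom_poly_eqI)
         (use that in \<open>simp_all add: g_def alg_hom_comp alg_hom_flip_swap alg_hom_elem_aut flip_aut_simps
           elem_aut_simps\<close>)
    have A: "\<epsilon> i * (if i = j then 1 else 0) = Poly_Mapping.lookup (s (flip_aut w) (fvar i)) (Word [j])"
      for i j
      using lookup_s_1[OF linear_in_TAut0(1), of w i "if i = w then - fvar w else fvar i" j]
      by (simp add: flip_aut_pvar abel_fvar \<epsilon>_def lookup_fvar alg_hom_uminus[OF alg_hom_abel])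
    have "(\<Sum>l\<in>UNIV. \<epsilon> i * (if i = l then 1 else 0) * t l j k) =
        (\<Sum>l\<in>UNIV. if i = l then \<epsilon> i * t l j k else 0)"
      by (intro sum.cong) auto
    moreover have "(\<Sum>a\<in>UNIV. \<Sum>b\<in>UNIV. t i a b *
          (\<epsilon> a * (if a = j then 1 else 0) * (\<epsilon> b * (if b = k then 1 else 0)))) =
        (\<Sum>a\<in>UNIV. \<Sum>b\<in>UNIV. if b = k then if a = j then t i a b * (\<epsilon> a * \<epsilon> b) else 0 else 0)"
      by (intro sum.cong) auto
    ultimately have "\<epsilon> i * t i j k = t i j k * (\<epsilon> j * \<epsilon> k)"
      using lookup_shift_conj[OF linear_in_TAut0(1) g comm g2 A, of i j k]
      by (simp flip: t_def)
    then show ?thesis by (simp only: \<epsilon>_def)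
  qed
  have neg: "t = 0" if "- t = t" for t :: 'a
  proof -
    have "2 * t = t + t" by simp
    also have "\<dots> = 0" by (subst that[symmetric]) simp
    finally show ?thesis using two by simp
  qed
  \<comment> \<open>A letter other than \<open>x\<close> and \<open>i\<close> that occurs exactly
    once changes the sign on one side of \<open>flip\<close> only.\<close>
  have off_diag: "t i j k = 0" if "j \<noteq> k" "j \<noteq> x \<and> j \<noteq> i \<or> k \<noteq> x \<and> k \<noteq> i" for i j k
    using flip[of j i j k] flip[of k i j k] that by (auto intro: neg)
  have off_diag': "t i i x = 0" if i: "i \<noteq> x" for i
  proof -
    let ?L = "elem_aut x (pvar z) :: ('v, 'a) pring \<Rightarrow> ('v, 'a) pring"
    have L: "?L \<in> TAut0"
      using xz by (intro elem_aut_in_TAut0 not_involving_intros aug_ideal_intros) auto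
    have comm: "?L \<circ> g = g \<circ> ?L"
      by (rule alg_hom_poly_eqI)
         (use xz in \<open>simp_all add: g_def alg_hom_comp alg_hom_elem_aut elem_aut_simps add_ac\<close>)
    define A :: "'v \<Rightarrow> 'v \<Rightarrow> 'a"
      where "A i j = (if i = j then 1 else 0) + (if i = x then if j = z then 1 else 0 else 0)" for i j
    have "A i j = Poly_Mapping.lookup (s ?L (fvar i)) (Word [j])" for i j
      using lookup_s_1[OF L, of i "if i = x then fvar x + fvar z else fvar i" j] xz
      by (simp add: elem_aut_pvar abel_fvar A_def lookup_fvar lookup_add alg_homD[OF alg_hom_abel])
    note * = lookup_shift_conj[OF L g comm g2 this, folded t_def]
    \<comment> \<open>The matrix is the identity plus one entry at row \<open>x\<close>, column
      \<open>z\<close>; these four forms isolate the columns and rows where that entry is absent or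
      present.\<close>
    have A_col: "A a j = (if a = j then 1 else 0)" if "j \<noteq> z" for a j using that by (simp add: A_def)
    have A_z: "A a z = (if a = z then 1 else 0) + (if a = x then 1 else 0)" for a by (simp add: A_def)
    have A_row: "A a l = (if l = a then 1 else 0)" if "a \<noteq> x" for a l using that by (auto simp: A_def)
    have A_x: "A x l = (if l = x then 1 else 0) + (if l = z then 1 else 0)" for l by (auto simp: A_def)
    show ?thesis
    proof (cases "i = z")
      case True
      \<comment> \<open>Row \<open>x\<close> and word \<open>zx\<close> of the equivariance
        equation; the surplus term \<open>t x x x\<close> is a vanishing diagonal
        coefficient.\<close>
      have "t x z x + t z z x = t x z x + t x x x"
        using *[of x z x] xz
        by (simp add: A_z A_col A_x distrib_left distrib_right sum.distrib mult_delta
            if_distrib[of "(*) (t x a b)" for a b] cong: if_cong)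
      then show ?thesis using True xz by (simp add: t_diag)
    next
      case False
      \<comment> \<open>Row \<open>i\<close> and word \<open>iz\<close>: only the column of
        \<open>z\<close> picks up an extra term, the one sought.\<close>
      have "t i i z = t i i z + t i i x"
        using *[of i i z] i False by (simp add: A_z A_col A_row distrib_left sum.distrib mult_delta)
      then show ?thesis by simp
    qed
  qed
  have "t i j k = (if i = x \<and> j = z \<and> k = z then c else 0)" for i j k
  proof (cases "j = k")
    case False
    then have "t i j k = 0"
      using off_diag[OF False, of i] off_diag'[of i] t_anti[of i x i]
      by (cases "j = x"; cases "k = x"; cases "j = i"; cases "k = i") simp_all
    with False show ?thesis by auto
  qed (auto simp: t_diag)
  then have "Poly_Mapping.lookup (shift g i - (if i = x then q else 0)) (Word [j, k]) = 0" for j k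
    unfolding lookup_minus t_def by (simp add: lookup_q)
  moreover have "shift g i - (if i = x then q else 0) \<in> fil 2" using g2 q2 by (simp add: fil_diff)
  ultimately have "shift g i - (if i = x then q else 0) \<in> fil 3" by (intro fil_3I)
  then show ?thesis by (simp only: q_def)
qed


section \<open>Commutators and cubic parts of lifts\<close>

lemma shift_comp:
  assumes "g \<in> TAut0" "h \<in> TAut0"
  shows "shift (g \<circ> h) i = shift g i + s g (shift h i)"
  by (simp add: s_comp[OF assms] alg_hom_diff[OF hom[OF assms(1)]])

text \<open>\<open>h\<close> is the commutator of \<open>f\<close>, adding \<open>a\<close> times
  the square of \<open>z\<close> to \<open>x\<close>, and \<open>g\<close>, adding \<open>W\<close>
  to \<open>z\<close>. Each lift is known modulo cubic terms; taking the commutator gains one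
  degree, so the lift of \<open>h\<close> is known modulo quartic terms.\<close>

lemma shift_commutator:
  fixes x y z i :: 'v and a b :: 'a
  defines "W \<equiv> cst b * (pvar y * pvar y) :: ('v, 'a) pring"
    and "w \<equiv> cst b * (fvar y * fvar y) :: ('v, 'a) free_alg"
  defines "h \<equiv> elem_aut x (- (cst a * (pvar z * W + W * pvar z + W * W)))"
  assumes xyz: "x \<noteq> y" "x \<noteq> z" "y \<noteq> z" and two: "(2 :: 'a) \<noteq> 0"
  shows "h \<in> TAut0" "shift h i - (if i = x then - (cst a * (fvar z * w + w * fvar z)) else 0) \<in> fil 4"
proof -
  define f g :: "('v, 'a) pring \<Rightarrow> ('v, 'a) pring"
    where "f = elem_aut x (cst a * (pvar z * pvar z))" and "g = elem_aut z W"
  have mem: "f \<in> TAut0" "g \<in> TAut0" 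
    unfolding f_def g_def h_def W_def using xyz
    by (intro elem_aut_in_TAut0 not_involving_intros aug_ideal_intros; simp)+
  show h: "h \<in> TAut0"
    unfolding h_def W_def using xyz
    by (intro elem_aut_in_TAut0 not_involving_intros aug_ideal_intros) auto
  have w2: "w \<in> fil 2" unfolding w_def by (intro fil_cst fil_mult[OF fil_fvar fil_fvar]) simp
  have comm: "f \<circ> g = h \<circ> (g \<circ> f)"
    by (rule alg_hom_poly_eqI)
       (use xyz in \<open>simp_all add: f_def g_def h_def W_def alg_hom_comp alg_hom_elem_aut elem_aut_simps
         algebra_simps\<close>)
  have f3: "shift f i - (if i = x then cst a * (fvar z * fvar z) else 0) \<in> fil 3" for i
    unfolding f_def using xyz(2) two by (rule shift_square)
  have g3: "shift g i - (if i = z then w else 0) \<in> fil 3" for i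
    unfolding g_def W_def w_def using xyz(3)[symmetric] two by (rule shift_square)
  have zz2: "cst a * (fvar z * fvar z) \<in> fil 2" by (intro fil_cst fil_mult[OF fil_fvar fil_fvar]) simp
  have f2: "shift f i \<in> fil 2" for i
    by (rule fil_of_diff[OF f3]) (simp_all add: zz2)
  have g2: "shift g i \<in> fil 2" for i
    by (rule fil_of_diff[OF g3]) (simp_all add: w2)
  define p where "p = - (cst a * (fvar z * w + w * fvar z + w * w))"
  have p2: "p \<in> fil 2"
    unfolding p_def by (intro fil_uminus fil_cst fil_add fil_mult[OF fil_fvar w2] fil_mult[OF w2 fil_fvar]
        fil_mult[OF w2 w2]) simp_all
  have h_eq: "h = elem_aut x (abel p)"
    by (simp add: h_def p_def w_def W_def alg_homD[OF alg_hom_abel] alg_hom_uminus[OF alg_hom_abel] abel_fvar)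
  have h2: "shift h i \<in> fil 2" for i
    using shift_fil_2[OF _ p2] h by (simp only: h_eq)
  note f = hom[OF mem(1)] and g = hom[OF mem(2)] and h_hom = hom[OF h]
  have moved2: "s f q - q \<in> fil n" "s g q - q \<in> fil n" "s h q - q \<in> fil n"
    if "q \<in> fil k" "n \<le> Suc k" for q k n
    using that f2 g2 h2
    by (rule_tac [!] fil_hom_minus_id[where m = 1 and k = k]) (simp_all add: f g h_hom numeral_2_eq_2)
  \<comment> \<open>The leading term \<open>w\<close> of \<open>shift g z\<close> involves only
    \<open>y\<close>, which \<open>s f\<close> moves in degree at least 3.\<close>
  have fg: "s f (shift g i) - shift g i \<in> fil 4" for i
  proof -
    let ?r = "shift g i - (if i = z then w else 0)"
    have y3: "shift f y \<in> fil 3" using f3[of y] xyz by simp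
    have "s f w - w = cst b * (fvar y * shift f y + shift f y * fvar y + shift f y * shift f y)"
      by (simp add: w_def alg_homD[OF f] algebra_simps)
    also have "\<dots> \<in> fil 4"
      by (intro fil_cst fil_add fil_mult[OF fil_fvar y3] fil_mult[OF y3 fil_fvar] fil_mult[OF y3 y3]) simp_all
    finally have "s f ?r - ?r + (if i = z then s f w - w else 0) \<in> fil 4"
      using moved2(1)[OF g3[of i], of 4] by (simp add: fil_add)
    then show ?thesis by (simp add: alg_hom_diff[OF f] alg_homD[OF f] split: if_splits)
  qed
  have gf: "s g (shift f i) - shift f i - (if i = x then cst a * (fvar z * w + w * fvar z) else 0) \<in> fil 4" for i
  proof -
    let ?r = "shift f i - (if i = x then cst a * (fvar z * fvar z) else 0)"
    define d where "d = shift g z - w"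
    have d: "d \<in> fil 3" using g3[of z] by (simp add: d_def)
    have "s g (fvar z) = fvar z + w + d" by (simp add: d_def)
    \<comment> \<open>Replacing \<open>z\<close> by \<open>z + w + d\<close> in its square: the
      terms linear in \<open>w\<close> are the cubic answer, all others have degree at least
      4.\<close>
    then have "s g (cst a * (fvar z * fvar z)) - cst a * (fvar z * fvar z) - cst a * (fvar z * w + w * fvar z) =
        cst a * (fvar z * d + d * fvar z + w * w + w * d + d * w + d * d)"
      by (simp add: alg_homD[OF g] algebra_simps)
    also have "\<dots> \<in> fil 4"
      by (intro fil_cst fil_add fil_mult[OF fil_fvar d] fil_mult[OF d fil_fvar] fil_mult[OF w2 w2]
          fil_mult[OF w2 d] fil_mult[OF d w2] fil_mult[OF d d]) simp_all
    finally have "s g ?r - ?r + (if i = x then s g (cst a * (fvar z * fvar z)) - cst a * (fvar z * fvar z) -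
        cst a * (fvar z * w + w * fvar z) else 0) \<in> fil 4"
      using moved2(2)[OF f3[of i], of 4] by (simp add: fil_add)
    then show ?thesis by (simp add: alg_hom_diff[OF g] alg_homD[OF g] algebra_simps split: if_splits)
  qed
  define r where "r i = shift (g \<circ> f) i" for i
  have gf_mem: "g \<circ> f \<in> TAut0" using mem by (intro comp_in_TAut_Aut0)
  have r2: "r i \<in> fil 2" for i
    unfolding r_def shift_comp[OF mem(2,1)] by (intro fil_add g2 fil_hom[OF g s_fil_1[OF mem(2)]] f2)
  \<comment> \<open>Both sides of \<open>comm\<close> expanded by \<open>shift_comp\<close>;
    \<open>solve\<close> is the remaining identity of additive groups.\<close>
  have eq: "shift h i = (s f (shift g i) - shift g i) - (s g (shift f i) - shift f i) - (s h (r i) - r i)" for i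
  proof -
    have solve: "H = (S - G) - (T - F) - (U - R)" if "F + S = H + U" "R = G + T"
      for F G H R S T U :: "('v, 'a) free_alg"
      using that by (simp add: algebra_simps)
    show ?thesis
    proof (rule solve)
      show "shift f i + s f (shift g i) = shift h i + s h (r i)"
        using shift_comp[OF mem, of i] shift_comp[OF h gf_mem, of i, folded r_def]
        by (simp only: comm)
      show "r i = shift g i + s g (shift f i)" unfolding r_def by (rule shift_comp[OF mem(2,1)])
    qed
  qed
  \<comment> \<open>Bootstrapping: all three differences in \<open>eq\<close> have degree at least
    3, hence so does \<open>shift h i\<close>. Then \<open>s h\<close> moves \<open>r i\<close> only
    in degree 4, and the last difference drops out modulo \<open>fil 4\<close>.\<close>
  have "shift h i \<in> fil 3" for i
    unfolding eq
    by (rule fil_diff[OF fil_diff[OF moved2(1)[OF g2] moved2(2)[OF f2]] moved2(3)[OF r2]]) simp_all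
  then have "s h (r i) - r i \<in> fil 4"
    by (intro fil_hom_minus_id[OF h_hom _ r2, of 2]) (simp_all add: numeral_3_eq_3 numeral_2_eq_2)
  then have "(s f (shift g i) - shift g i) - (s g (shift f i) - shift f i -
      (if i = x then cst a * (fvar z * w + w * fvar z) else 0)) - (s h (r i) - r i) \<in> fil 4"
    by (rule fil_diff[OF fil_diff[OF fg gf]])
  then show "shift h i - (if i = x then - (cst a * (fvar z * w + w * fvar z)) else 0) \<in> fil 4"
    unfolding eq by (simp add: algebra_simps split: if_splits)
qed

text \<open>The quartic term \<open>W b * W b\<close> is the same for \<open>b = 1\<close> and
  \<open>b = - 1\<close>, while the cubic terms have opposite signs. So \<open>k\<close> is the
  quotient of the two commutators, and its lift is the difference of theirs modulo quartic
  terms.\<close>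

lemma shift_cubic:
  fixes x y z i :: 'v and a :: 'a
  defines "k \<equiv> elem_aut x (cst (4 * a) * (pvar z * (pvar y * pvar y))) :: ('v, 'a) pring \<Rightarrow> ('v, 'a) pring"
  assumes xyz: "x \<noteq> y" "x \<noteq> z" "y \<noteq> z" and two: "(2 :: 'a) \<noteq> 0"
  shows "k \<in> TAut0"
    "shift k i - (if i = x then cst (2 * a) * (fvar z * fvar y * fvar y + fvar y * fvar y * fvar z) else 0) \<in> fil 4"
proof -
  show k: "k \<in> TAut0"
    unfolding k_def using xyz by (intro elem_aut_in_TAut0 not_involving_intros aug_ideal_intros) auto
  define W :: "'a \<Rightarrow> ('v, 'a) pring" where "W b = cst b * (pvar y * pvar y)" for b
  define w :: "'a \<Rightarrow> ('v, 'a) free_alg" where "w b = cst b * (fvar y * fvar y)" for b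
  define h where "h b = elem_aut x (- (cst a * (pvar z * W b + W b * pvar z + W b * W b)))" for b
  note h = shift_commutator[OF xyz two, where a = a, folded W_def w_def, folded h_def]
  have cst4: "cst (4 * a) = (cst a + cst a + cst a + cst a :: ('v, 'a) pring)"
    by (simp flip: single_add)
  have "k \<circ> h 1 = elem_aut x (cst (4 * a) * (pvar z * (pvar y * pvar y)) +
      - (cst a * (pvar z * W 1 + W 1 * pvar z + W 1 * W 1)))"
    unfolding k_def h_def W_def using xyz by (intro elem_aut_add not_involving_intros) auto
  also have "\<dots> = h (- 1)"
    unfolding h_def by (rule arg_cong[where f = "elem_aut x"])
      (simp only: W_def cst4, simp add: single_uminus algebra_simps)
  finally have kh: "shift (h (- 1)) i = shift k i + s k (shift (h 1) i)"
    using shift_comp[OF k h(1)[of 1], of i] by simp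
  have abel: "cst (4 * a) * (pvar z * (pvar y * pvar y)) =
      abel (cst (4 * a) * (fvar z * (fvar y * fvar y)) :: ('v, 'a) free_alg)"
    by (simp add: alg_homD[OF alg_hom_abel] abel_fvar)
  have p2: "cst (4 * a) * (fvar z * (fvar y * fvar y)) \<in> fil 2"
    by (intro fil_cst fil_mult[OF fil_fvar fil_mult[OF fil_fvar fil_fvar, of 2]]) simp_all
  have k2: "shift k i \<in> fil 2" for i
    unfolding k_def abel by (rule shift_fil_2[OF _ p2]) (use k in \<open>simp only: k_def abel\<close>)
  let ?r = "\<lambda>b. if i = x then - (cst a * (fvar z * w b + w b * fvar z)) else 0"
  have w2: "w 1 \<in> fil 2" unfolding w_def by (intro fil_cst fil_mult[OF fil_fvar fil_fvar]) simp
  have "- (cst a * (fvar z * w 1 + w 1 * fvar z)) \<in> fil 3"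
    by (intro fil_uminus fil_cst fil_add fil_mult[OF fil_fvar w2] fil_mult[OF w2 fil_fvar]) simp_all
  then have r3: "?r 1 \<in> fil 3" by simp
  have "shift (h 1) i \<in> fil 3"
    by (rule fil_of_diff[OF h(2) r3]) simp
  then have "s k (shift (h 1) i) - shift (h 1) i \<in> fil 4"
    by (rule fil_hom_minus_id[OF hom[OF k] k2[unfolded numeral_2_eq_2]]) simp
  then have "(shift (h (- 1)) i - ?r (- 1)) - (shift (h 1) i - ?r 1) -
      (s k (shift (h 1) i) - shift (h 1) i) \<in> fil 4"
    by (rule fil_diff[OF fil_diff[OF h(2) h(2)]])
  moreover have "cst (2 * a) = (cst a + cst a :: ('v, 'a) free_alg)" by (simp flip: single_add)
  ultimately show "shift k i -
      (if i = x then cst (2 * a) * (fvar z * fvar y * fvar y + fvar y * fvar y * fvar z) else 0) \<in> fil 4"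
    unfolding kh by (simp add: w_def single_uminus algebra_simps mult.assoc split: if_splits)
qed

text \<open>\<open>k\<close> is the conjugate of the map in \<open>shift_cubic\<close> with
  \<open>a = 1\<close> by the transvection \<open>L\<close> adding \<open>e\<close> times
  \<open>z\<close> to \<open>y\<close>. After this substitution each of the words \<open>zyy\<close>
  and \<open>yyz\<close>, of coefficient 2, contributes \<open>2 * e\<close> to the word
  \<open>zyz\<close>.\<close>

lemma lookup_shift_cubic_conj:
  fixes x y z :: 'v and e :: 'a
  defines "V \<equiv> pvar y + cst e * pvar z :: ('v, 'a) pring"
  defines "k \<equiv> elem_aut x (cst 4 * (pvar z * (V * V)))"
  assumes xyz: "x \<noteq> y" "x \<noteq> z" "y \<noteq> z" and two: "(2 :: 'a) \<noteq> 0"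
  shows "k \<in> TAut0" "shift k i \<in> fil 3"
    "Poly_Mapping.lookup (shift k x) (Word [z, y, z]) = 4 * e"
proof -
  show k: "k \<in> TAut0"
    unfolding k_def V_def using xyz by (intro elem_aut_in_TAut0 not_involving_intros aug_ideal_intros) auto
  define k0 :: "('v, 'a) pring \<Rightarrow> ('v, 'a) pring"
    where "k0 = elem_aut x (cst (4 * 1) * (pvar z * (pvar y * pvar y)))"
  define q :: "('v, 'a) free_alg"
    where "q = cst (2 * 1) * (fvar z * fvar y * fvar y + fvar y * fvar y * fvar z)"
  note k0 = shift_cubic[OF xyz two, where a = 1, folded k0_def q_def]
  have fvar3: "fvar i * fvar j * fvar l \<in> fil 3" for i j l :: 'v
    by (intro fil_mult[OF fil_mult[OF fil_fvar fil_fvar, of 2] fil_fvar]) simp_all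
  have q3: "q \<in> fil 3" unfolding q_def by (intro fil_cst fil_add fvar3)
  have k03: "shift k0 i \<in> fil 3" for i
    by (rule fil_of_diff[OF k0(2)]) (simp_all add: q3)
  define L :: "('v, 'a) pring \<Rightarrow> ('v, 'a) pring" where "L = elem_aut y (cst e * pvar z)"
  have L: "L \<in> TAut0"
    unfolding L_def using xyz by (intro elem_aut_in_TAut0 not_involving_intros aug_ideal_intros) auto
  have comm: "L \<circ> k0 = k \<circ> L"
    by (rule alg_hom_poly_eqI)
       (use xyz in \<open>simp_all add: k0_def k_def L_def V_def alg_hom_comp alg_hom_elem_aut elem_aut_simps\<close>)
  define v :: "('v, 'a) free_alg" where "v = fvar y + cst e * fvar z"
  have v1: "v \<in> fil (Suc 0)" unfolding v_def by (intro fil_add fil_cst fil_fvar)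
  have A: "Poly_Mapping.lookup (s L (fvar i)) (Word [j]) =
      (if j = i then 1 else 0) + (if j = z then if i = y then e else 0 else 0)" for i j
    using lookup_s_1[OF L, of i "if i = y then v else fvar i" j]
    by (auto simp: L_def elem_aut_pvar abel_fvar v_def lookup_fvar lookup_add lookup_cst_mult
        alg_homD[OF alg_hom_abel])
  have sum: "(\<Sum>l\<in>UNIV. cst (Poly_Mapping.lookup (s L (fvar i)) (Word [l])) * shift k l) =
      shift k i + (if i = y then cst e * shift k z else 0)" for i
  proof -
    have "cst (Poly_Mapping.lookup (s L (fvar i)) (Word [l])) * shift k l =
        (if l = i then shift k l else 0) + (if l = z then if i = y then cst e * shift k l else 0 else 0)" for l
      unfolding A by (simp add: single_add distrib_right)
    then show ?thesis by (simp add: sum.distrib)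
  qed
  have abel: "cst 4 * (pvar z * (V * V)) = abel (cst 4 * (fvar z * (v * v)))"
    by (simp add: alg_homD[OF alg_hom_abel] abel_fvar v_def V_def del: single_numeral)
  have p2: "cst 4 * (fvar z * (v * v)) \<in> fil 2"
    by (intro fil_cst fil_mult[OF fil_fvar fil_mult[OF v1 v1, of 2]]) simp_all
  have k2: "shift k i \<in> fil 2" for i
    unfolding k_def abel by (rule shift_fil_2[OF _ p2]) (use k in \<open>simp only: k_def abel\<close>)
  \<comment> \<open>With only \<open>k2\<close> available, conjugation is controlled modulo cubic
    terms. This already gives \<open>shift k i \<in> fil 3\<close>, first for \<open>i = z\<close>
    and then for all \<open>i\<close>, after which the same formula is exact modulo quartic
    terms.\<close>
  have *: "shift k i + (if i = y then cst e * shift k z else 0) \<in> fil 3" for i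
  proof -
    have "s L (shift k0 i) - (shift k i + (if i = y then cst e * shift k z else 0)) \<in> fil 3"
      using shift_conj_fil[OF L k0(1) k comm k2[unfolded numeral_2_eq_2], of i]
      by (simp only: sum numeral_3_eq_3)
    then show ?thesis by (rule fil_diff_cancel[OF fil_hom[OF hom[OF L] s_fil_1[OF L] k03]])
  qed
  have k3: "shift k i \<in> fil 3" for i
  proof -
    have z: "shift k z \<in> fil 3" using *[of z] xyz by simp
    show ?thesis using fil_diff[OF *[of i], of "if i = y then cst e * shift k z else 0"] z
      by (simp add: fil_cst split: if_splits)
  qed
  show "shift k i \<in> fil 3" by (rule k3)
  have "s L (shift k0 x) - shift k x \<in> fil 4"
    using shift_conj_fil[OF L k0(1) k comm k3[unfolded numeral_3_eq_3], of x] xyz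
    by (simp add: sum eval_nat_numeral)
  moreover have "s L (shift k0 x - q) \<in> fil 4"
    using k0(2)[of x] by (intro fil_hom[OF hom[OF L] s_fil_1[OF L]]) simp
  ultimately have "shift k x - s L q \<in> fil 4"
    unfolding alg_hom_diff[OF hom[OF L], of "shift k0 x"] by (rule fil_diff_swap)
  from fil_lookup[OF this, of "Word [z, y, z]"]
  show "Poly_Mapping.lookup (shift k x) (Word [z, y, z]) = 4 * e"
    using xyz by (simp add: q_def alg_homD[OF hom[OF L]] lookup_cst_mult lookup_add lookup_mult_111
        s_fil_1[OF L] A del: single_numeral)
qed

lemma no_three_variables:
  fixes x y z :: 'v
  assumes xyz: "x \<noteq> y" "x \<noteq> z" "y \<noteq> z"
  shows False
proof -
  have two: "(2 :: 'a) \<noteq> 0" by (rule char_neq_2[OF xyz])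
  define V :: "'a \<Rightarrow> ('v, 'a) pring" where "V e = pvar y + cst e * pvar z" for e
  define k where "k e = elem_aut x (cst 4 * (pvar z * (V e * V e)))" for e
  note k = lookup_shift_cubic_conj[OF xyz two, folded V_def, folded k_def]
  \<comment> \<open>The difference of \<open>k 1\<close> and \<open>k (- 1)\<close>: the squares of
    \<open>y + z\<close> and \<open>y - z\<close> differ by \<open>4yz\<close>. It is again covered
    by \<open>shift_cubic\<close>, with \<open>y\<close> and \<open>z\<close> exchanged and
    \<open>a = 4\<close>, and that lift has no \<open>zyz\<close> term.\<close>
  define d :: "('v, 'a) pring \<Rightarrow> ('v, 'a) pring"
    where "d = elem_aut x (cst (4 * 4) * (pvar y * (pvar z * pvar z)))"
  note d = shift_cubic[OF xyz(2,1) xyz(3)[symmetric] two, where a = 4, folded d_def]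
  have "d \<circ> k (- 1) = elem_aut x (cst (4 * 4) * (pvar y * (pvar z * pvar z)) +
      cst 4 * (pvar z * (V (- 1) * V (- 1))))"
    unfolding d_def k_def V_def using xyz by (intro elem_aut_add not_involving_intros) auto
  also have "\<dots> = k 1"
    unfolding k_def by (rule arg_cong[where f = "elem_aut x"])
      (simp add: V_def single_uminus algebra_simps)
  finally have dk: "shift (k 1) x = shift d x + s d (shift (k (- 1)) x)"
    using shift_comp[OF d(1) k(1)[of "- 1"], of x] by simp
  have fvar3: "fvar i * fvar j * fvar l \<in> fil 3" for i j l :: 'v
    by (intro fil_mult[OF fil_mult[OF fil_fvar fil_fvar, of 2] fil_fvar]) simp_all
  define q :: "('v, 'a) free_alg"
    where "q = cst (2 * 4) * (fvar y * fvar z * fvar z + fvar z * fvar z * fvar y)"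
  have q2: "q \<in> fil 2" unfolding q_def by (intro fil_cst fil_add fil_mono[OF fvar3]) simp_all
  have d2: "shift d i \<in> fil 2" for i
    by (rule fil_of_diff[OF d(2)[folded q_def]]) (simp_all add: q2)
  have "s d (shift (k (- 1)) x) - shift (k (- 1)) x \<in> fil 4"
    by (rule fil_hom_minus_id[OF hom[OF d(1)] d2[unfolded numeral_2_eq_2] k(2)]) simp
  from fil_lookup[OF this, of "Word [z, y, z]"]
  have "Poly_Mapping.lookup (shift (k 1) x) (Word [z, y, z]) =
      Poly_Mapping.lookup (shift d x) (Word [z, y, z]) + Poly_Mapping.lookup (shift (k (- 1)) x) (Word [z, y, z])"
    by (simp add: dk lookup_add)
  moreover have "Poly_Mapping.lookup (shift d x) (Word [z, y, z]) = 0"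
    using fil_lookup[OF d(2)[of x], of "Word [z, y, z]"] xyz
    by (simp add: lookup_cst_mult lookup_add lookup_mult_111 fil_fvar lookup_fvar del: single_numeral)
  \<comment> \<open>Comparing coefficients of \<open>zyz\<close> gives
    \<open>4 = 0 + (- 4)\<close>.\<close>
  ultimately have "(8 :: 'a) = 0" by (simp add: k(3) eq_neg_iff_add_eq_0)
  then have "(2 :: 'a) ^ 3 = 0" by simp
  with power_not_zero[OF two] show False by blast
qed

end

section \<open>From the isomorphism to a section\<close>

lemma three_variables:
  assumes "CARD('v::finite) > 2"
  shows "\<exists>x y z :: 'v. x \<noteq> y \<and> x \<noteq> z \<and> y \<noteq> z"
proof -
  have "3 \<le> card (UNIV :: 'v set)" using assms by simp
  then obtain A :: "'v set" where "card A = 3" by (rule obtain_subset_with_card_n)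
  then show ?thesis by (auto simp: card_3_iff)
qed

text \<open>Formulated for every \<open>G\<close> above \<open>TAut0\<close>, so that it applies to
  \<open>Aut0\<close> and \<open>NAut\<close> alike.\<close>

lemma no_section_over_supergroup:
  fixes G :: "(('v::finite, 'a::field) pring \<Rightarrow> ('v, 'a) pring) set"
  assumes card: "CARD('v) > 2" and G: "TAut0 \<subseteq> G" 
    and H: "subgroup H (Aut_free :: (('v, 'a) free_alg \<Rightarrow> _) monoid)"
    and iso: "abel_aut \<in> iso (Aut_free\<lparr>carrier := H\<rparr>) (Aut_poly\<lparr>carrier := G\<rparr>)"
  shows False
proof -
  have bij: "bij_betw abel_aut H G" using iso by (simp add: iso_def)
  define s where "s = inv_into H abel_aut"
  have s: "s g \<in> H" "abel_aut (s g) = g" if "g \<in> TAut0" for g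
    using that G bij unfolding s_def by (auto simp: bij_betw_def inv_into_into f_inv_into_f)
  have Aut: "s g \<in> carrier Aut_free" if "g \<in> TAut0" for g
    using s(1)[OF that] subgroup.subset[OF H] by blast
  interpret abel_section s
  proof
    fix g h :: "('v, 'a) pring \<Rightarrow> ('v, 'a) pring" and i :: 'v
    assume g: "g \<in> TAut0"
    show "alg_hom (s g)" using Aut[OF g] by simp
    show "abel (s g (fvar i)) = g (pvar i)"
      using abel_aut(2)[OF Aut[OF g]] s(2)[OF g] by (metis abel_fvar comp_apply)
    assume h: "h \<in> TAut0"
    \<comment> \<open>Both \<open>s (g \<circ> h)\<close> and \<open>s g \<circ> s h\<close> lie in
      \<open>H\<close> over \<open>g \<circ> h\<close>, and \<open>abel_aut\<close> is injective on
      \<open>H\<close>.\<close>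
    have "abel_aut (s g \<circ> s h) = g \<circ> h"
      using hom_mult[OF abel_aut_hom Aut[OF g] Aut[OF h]] s(2)[OF g] s(2)[OF h] by simp
    moreover have "s g \<circ> s h \<in> H" using subgroup.m_closed[OF H s(1)[OF g] s(1)[OF h]] by simp
    moreover note s[OF comp_in_TAut_Aut0[OF g h]]
    ultimately show "s (g \<circ> h) = s g \<circ> s h"
      using bij by (metis bij_betw_def inj_onD)
  qed
  obtain x y z :: 'v where "x \<noteq> y" "x \<noteq> z" "y \<noteq> z" using three_variables[OF card] by blast
  then show False by (rule no_three_variables)
qed

theorem theorem1p9:
  assumes "CARD('v::finite) > 2"
  shows "(\<nexists>H. subgroup H (Aut_free :: (('v, 'a::field) free_alg \<Rightarrow> ('v, 'a) free_alg) monoid) \<and>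
            abel_aut \<in> iso (Aut_free\<lparr>carrier := H\<rparr>) (Aut_poly\<lparr>carrier := Aut0\<rparr>)) \<and>
         (\<nexists>H. subgroup H (Aut_free :: (('v, 'a) free_alg \<Rightarrow> ('v, 'a) free_alg) monoid) \<and>
            abel_aut \<in> iso (Aut_free\<lparr>carrier := H\<rparr>) (Aut_poly\<lparr>carrier := NAut\<rparr>))"
  using no_section_over_supergroup[OF assms, where 'a = 'a] TAut_subset_NAut by blast

end
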